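(* For every $\tau$ in the upper half plane with $\operatorname{Im}(\tau)>1.25$ one has $$\frac{1}{2\pi \operatorname{Im}(\tau)}\sqrt{\frac{J(\tau)}{J(\tau)-1}} = \sum_{n=0}^\infty \left( \frac{1-s_2(\tau)}{6} + n \right)\cdot \frac{(6n)!}{(3n)!\,(n!)^3}\cdot \frac{1}{\left(1728J(\tau)\right)^n},$$ where $\sqrt{\cdot}$ denotes the principal branch of the square root (and the series converges absolutely).
   Context: For $\tau$ in the upper half plane $\mathbb H=\{\tau\in\mathbb C:\operatorname{Im}\tau>0\}$ put $q=e^{2\pi i\tau}$ and define the normalized Eisenstein series $E_2(\tau)=1-24\sum_{n\ge1} n\frac{q^n}{1-q^n}$, $E_4(\tau)=1+240\sum_{n\ge1} n^3\frac{q^n}{1-q^n}$, $E_6(\tau)=1-504\sum_{n\ge1} n^5\frac{q^n}{1-q^n}$. Define $J(\tau)=\dfrac{E_4(\tau)^3}{E_4(\tau)^3-E_6(\tau)^2}$ and $s_2(\tau)=\dfrac{E_4(\tau)}{E_6(\tau)}\left(E_2(\tau)-\dfrac{3}{\pi\operatorname{Im}(\tau)}\right)$. *)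

theory Defs
  imports "HOL-Analysis.Analysis"
begin

definition qnome :: "complex \<Rightarrow> complex" where
  "qnome \<tau> = exp (2 * complex_of_real pi * \<i> * \<tau>)"

definition E2 :: "complex \<Rightarrow> complex" where
  "E2 \<tau> = 1 - 24 * (\<Sum>n. of_nat (Suc n) * qnome \<tau> ^ Suc n / (1 - qnome \<tau> ^ Suc n))"

definition E4 :: "complex \<Rightarrow> complex" where
  "E4 \<tau> = 1 + 240 * (\<Sum>n. of_nat (Suc n) ^ 3 * qnome \<tau> ^ Suc n / (1 - qnome \<tau> ^ Suc n))"

definition E6 :: "complex \<Rightarrow> complex" where
  "E6 \<tau> = 1 - 504 * (\<Sum>n. of_nat (Suc n) ^ 5 * qnome \<tau> ^ Suc n / (1 - qnome \<tau> ^ Suc n))"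

definition Jfun :: "complex \<Rightarrow> complex" where
  "Jfun \<tau> = E4 \<tau> ^ 3 / (E4 \<tau> ^ 3 - E6 \<tau> ^ 2)"

definition s2 :: "complex \<Rightarrow> complex" where
  "s2 \<tau> = E4 \<tau> / E6 \<tau> * (E2 \<tau> - 3 / (complex_of_real pi * complex_of_real (Im \<tau>)))"

end

theory Submission
  imports Defs "HOL-Complex_Analysis.Complex_Analysis"
begin

text \<open>Put \<open>t = 1/J\<close>. Ramanujan's differential equations for \<open>E\<^sub>2\<close>, \<open>E\<^sub>4\<close>, \<open>E\<^sub>6\<close> amount to divisor sum
  convolutions, and they imply \<open>(E\<^sub>4/E\<^sub>6) q dt/dq = t\<close>. Hence \<open>\<surd>E\<^sub>4\<close>, viewed as a function of \<open>t\<close>, satisfies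
  the third-order hypergeometric equation of \<open>F(t) = \<Sum> (6n)!/((3n)! n!\<^sup>3) (t/1728)\<^sup>n\<close>, and \<open>F(t) = \<surd>E\<^sub>4\<close>
  because this equation has only one power series solution with constant term 1. Differentiating gives
  \<open>t F'(t) = \<surd>E\<^sub>4 (E\<^sub>2 E\<^sub>4/E\<^sub>6 - 1)/6\<close>; in the combination \<open>(1 - s\<^sub>2)/6 F + t F'\<close> all terms but the
  non-holomorphic one cancel, leaving \<open>E\<^sub>4\<^sup>3\<^sup>/\<^sup>2/(2\<pi> Im(\<tau>) E\<^sub>6)\<close>. No modularity is used: the power series identities
  extend by analytic continuation to \<open>|q| < 1/2500\<close>, where \<open>|t| < 1\<close> and \<open>E\<^sub>4\<close>, \<open>E\<^sub>6\<close> are close to 1.\<close>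

unbundle no vec_syntax

section \<open>Sums over solutions of ax + by = n\<close>

text \<open>A solution is a pair of factorized positive numbers \<open>a * x\<close>,
  \<open>b * y\<close> with sum \<open>n\<close>; sums over these are coefficients of products of
  divisor sum series (\<open>sigma_fps_mult_nth\<close>).\<close>

definition quads :: "nat \<Rightarrow> (nat \<times> nat \<times> nat \<times> nat) set" where
  "quads n = {(a, b, x, y). 0 < a \<and> 0 < b \<and> 0 < x \<and> 0 < y \<and> a * x + b * y = n}"

text \<open>The range \<open>{1..n}\<close> makes \<open>divisors 0\<close> empty, so the divisor
  sum series have constant term 0.\<close>

definition divisors :: "nat \<Rightarrow> nat set" where
  "divisors n = {d \<in> {1..n}. d dvd n}"

lemma finite_divisors [simp, intro]: "finite (divisors n)"
  by (simp add: divisors_def)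

lemma le_mult_of_pos:
  fixes a x :: nat
  assumes "0 < x"
  shows "a \<le> a * x" "a \<le> x * a"
  using assms by auto

lemma finite_quads [simp, intro]: "finite (quads n)"
proof (rule finite_subset)
  show "quads n \<subseteq> {..n} \<times> {..n} \<times> {..n} \<times> {..n}"
  proof safe
    fix a b x y assume "(a, b, x, y) \<in> quads n"
    then have *: "0 < a" "0 < b" "0 < x" "0 < y" "a * x + b * y = n"
      by (auto simp: quads_def)
    show "a \<le> n" "b \<le> n" "x \<le> n" "y \<le> n"
      using * le_mult_of_pos[of x a] le_mult_of_pos[of a x] le_mult_of_pos[of y b] le_mult_of_pos[of b y]
      by linarith+
  qed
qed auto

text \<open>The bijection rests on \<open>a * x + b * y = a * (x - y) + (a + b) * y\<close>; the old
  \<open>b\<close> is the new \<open>b - a\<close>.\<close>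

lemma sum_quads_diff_right:
  fixes g :: "nat \<Rightarrow> nat \<Rightarrow> 'a::comm_monoid_add"
  shows "(\<Sum>(a, b, x, y) \<in> {(a, b, x, y) \<in> quads n. y < x}. g a b) =
         (\<Sum>(a, b, x, y) \<in> {(a, b, x, y) \<in> quads n. a < b}. g a (b - a))"
  by (rule sum.reindex_bij_witness[of _ "\<lambda>(a, b, x, y). (a, b - a, x + y, y)"
             "\<lambda>(a, b, x, y). (a, a + b, x - y, y)"])
     (auto simp: quads_def algebra_simps diff_mult_distrib diff_mult_distrib2
          mult_le_mono trans_le_add1 less_imp_le)

lemma sum_quads_diff_left:
  fixes g :: "nat \<Rightarrow> nat \<Rightarrow> 'a::comm_monoid_add"
  shows "(\<Sum>(a, b, x, y) \<in> {(a, b, x, y) \<in> quads n. x < y}. g a b) =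
         (\<Sum>(a, b, x, y) \<in> {(a, b, x, y) \<in> quads n. b < a}. g (a - b) b)"
  by (rule sum.reindex_bij_witness[of _ "\<lambda>(a, b, x, y). (a - b, b, x, x + y)"
             "\<lambda>(a, b, x, y). (a + b, b, x, y - x)"])
     (auto simp: quads_def algebra_simps diff_mult_distrib diff_mult_distrib2
          mult_le_mono trans_le_add1 less_imp_le)

text \<open>On this diagonal \<open>(a + b) * x = n\<close>, so \<open>d = a + b\<close> runs
  through the divisors of \<open>n\<close>.\<close>

lemma sum_quads_eq_right:
  fixes g :: "nat \<Rightarrow> nat \<Rightarrow> 'a::comm_monoid_add"
  shows "(\<Sum>(a, b, x, y) \<in> {(a, b, x, y) \<in> quads n. x = y}. g a b) =
         (\<Sum>d\<in>divisors n. \<Sum>a\<in>{1..<d}. g a (d - a))"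
proof -
  have "(\<Sum>d\<in>divisors n. \<Sum>a\<in>{1..<d}. g a (d - a)) =
        (\<Sum>(d, a)\<in>Sigma (divisors n) (\<lambda>d. {1..<d}). g a (d - a))"
    by (rule sum.Sigma) auto
  also have "\<dots> = (\<Sum>(a, b, x, y) \<in> {(a, b, x, y) \<in> quads n. x = y}. g a b)"
    by (rule sum.reindex_bij_witness[of _ "\<lambda>(a, b, x, y). (a + b, a)"
             "\<lambda>(d, a). (a, d - a, n div d, n div d)"])
       (auto simp: quads_def divisors_def Suc_le_eq
          simp flip: add_mult_distrib add_mult_distrib2)
  finally show ?thesis ..
qed

text \<open>Here \<open>a * (x + y) = n\<close>, and \<open>d = a\<close> leaves
  \<open>n div d - 1\<close> ways to split \<open>n div d\<close> into positive \<open>x\<close> and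
  \<open>y\<close>.\<close>

lemma sum_quads_eq_left:
  fixes k :: "nat \<Rightarrow> 'a::comm_semiring_1"
  shows "(\<Sum>(a, b, x, y) \<in> {(a, b, x, y) \<in> quads n. a = b}. k a) =
         (\<Sum>d\<in>divisors n. of_nat (n div d - 1) * k d)"
proof -
  have "(\<Sum>d\<in>divisors n. of_nat (n div d - 1) * k d) =
        (\<Sum>d\<in>divisors n. \<Sum>x\<in>{1..<n div d}. k d)"
    by simp
  also have "\<dots> = (\<Sum>(d, x)\<in>Sigma (divisors n) (\<lambda>d. {1..<n div d}). k d)"
    by (rule sum.Sigma) auto
  also have "\<dots> = (\<Sum>(a, b, x, y) \<in> {(a, b, x, y) \<in> quads n. a = b}. k a)"
    by (rule sum.reindex_bij_witness[of _ "\<lambda>(a, b, x, y). (a, x)"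
             "\<lambda>(d, x). (d, d, x, n div d - x)"])
       (auto simp: quads_def divisors_def Suc_le_eq
          simp flip: add_mult_distrib add_mult_distrib2)
  finally show ?thesis ..
qed

text \<open>Skoruppa's argument: \<open>(a, b, x, y) \<mapsto> (a, a + b, x - y, y)\<close> maps the solutions of \<open>ax + by = n\<close> with
  \<open>x > y\<close> onto those with \<open>a < b\<close>, so a function \<open>h\<close> that is a difference of some \<open>g\<close> along these maps
  has a sum supported on the diagonals \<open>x = y\<close> and \<open>a = b\<close>.\<close>

lemma sum_quads_telescope:
  fixes g h :: "nat \<Rightarrow> nat \<Rightarrow> 'a::comm_ring_1"
  assumes g_commute: "\<And>a b. g a b = g b a" and h_commute: "\<And>a b. h a b = h b a"
      and diff: "\<And>a c. g a (a + c) - g a c = h a (a + c)"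
  shows "(\<Sum>(a, b, x, y) \<in> quads n. h a b) =
           (\<Sum>d\<in>divisors n. \<Sum>a\<in>{1..<d}. g a (d - a))
           - (\<Sum>d\<in>divisors n. of_nat (n div d - 1) * (g d d - h d d))"
proof -
  have split: "(\<Sum>z\<in>quads n. F z) = sum F {z\<in>quads n. r z < (s z :: nat)} +
       sum F {z\<in>quads n. s z < r z} + sum F {z\<in>quads n. r z = s z}"
    for F :: "_ \<Rightarrow> 'a" and r s
  proof -
    have "quads n = ({z\<in>quads n. r z < s z} \<union> {z\<in>quads n. s z < r z}) \<union> {z\<in>quads n. r z = s z}"
      by auto
    also have "sum F \<dots> = sum F ({z\<in>quads n. r z < s z} \<union> {z\<in>quads n. s z < r z})
                 + sum F {z\<in>quads n. r z = s z}"
      by (rule sum.union_disjoint) auto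
    also have "sum F ({z\<in>quads n. r z < s z} \<union> {z\<in>quads n. s z < r z}) =
                 sum F {z\<in>quads n. r z < s z} + sum F {z\<in>quads n. s z < r z}"
      by (rule sum.union_disjoint) auto
    finally show ?thesis .
  qed
  have splitx: "(\<Sum>(a, b, x, y) \<in> quads n. k a b) =
       (\<Sum>(a, b, x, y) \<in> {(a, b, x, y) \<in> quads n. x < y}. k a b) +
       (\<Sum>(a, b, x, y) \<in> {(a, b, x, y) \<in> quads n. y < x}. k a b) +
       (\<Sum>(a, b, x, y) \<in> {(a, b, x, y) \<in> quads n. x = y}. k a b)" for k :: "nat \<Rightarrow> nat \<Rightarrow> 'a"
    using split[of "\<lambda>(a, b, x, y). k a b" "\<lambda>(a, b, x, y). x" "\<lambda>(a, b, x, y). y"]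
    by (simp add: case_prod_unfold)
  have splita: "(\<Sum>(a, b, x, y) \<in> quads n. k a b) =
       (\<Sum>(a, b, x, y) \<in> {(a, b, x, y) \<in> quads n. a < b}. k a b) +
       (\<Sum>(a, b, x, y) \<in> {(a, b, x, y) \<in> quads n. b < a}. k a b) +
       (\<Sum>(a, b, x, y) \<in> {(a, b, x, y) \<in> quads n. a = b}. k a b)" for k :: "nat \<Rightarrow> nat \<Rightarrow> 'a"
    using split[of "\<lambda>(a, b, x, y). k a b" "\<lambda>(a, b, x, y). a" "\<lambda>(a, b, x, y). b"]
    by (simp add: case_prod_unfold)
  have less: "(\<Sum>(a, b, x, y) \<in> {(a, b, x, y) \<in> quads n. a < b}. g a (b - a)) =
              (\<Sum>(a, b, x, y) \<in> {(a, b, x, y) \<in> quads n. a < b}. g a b - h a b)"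
  proof (intro sum.cong refl, safe)
    fix a b :: nat assume "a < b"
    then show "g a (b - a) = g a b - h a b"
      using diff[of a "b - a"] by (simp add: algebra_simps)
  qed
  have greater: "(\<Sum>(a, b, x, y) \<in> {(a, b, x, y) \<in> quads n. b < a}. g (a - b) b) =
              (\<Sum>(a, b, x, y) \<in> {(a, b, x, y) \<in> quads n. b < a}. g a b - h a b)"
  proof (intro sum.cong refl, safe)
    fix a b :: nat assume "b < a"
    then show "g (a - b) b = g a b - h a b"
      using diff[of b "a - b"] g_commute[of a b] h_commute[of a b] g_commute[of "a - b" b]
      by (simp add: algebra_simps)
  qed
  have diag: "(\<Sum>(a, b, x, y) \<in> {(a, b, x, y) \<in> quads n. a = b}. g a b - h a b) =
              (\<Sum>(a, b, x, y) \<in> {(a, b, x, y) \<in> quads n. a = b}. g a a - h a a)"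
    by (intro sum.cong) auto
  \<comment> \<open>The off-diagonal parts of \<open>g\<close>, split by \<open>x\<close> and
    \<open>y\<close>, equal those of \<open>g - h\<close>, split by \<open>a\<close> and
    \<open>b\<close>. Only diagonals remain, and the full sum of \<open>g\<close> cancels at the
    end.\<close>
  have "(\<Sum>(a, b, x, y) \<in> quads n. g a b) =
      (\<Sum>(a, b, x, y) \<in> quads n. g a b - h a b)
      - (\<Sum>d\<in>divisors n. of_nat (n div d - 1) * (g d d - h d d))
      + (\<Sum>d\<in>divisors n. \<Sum>a\<in>{1..<d}. g a (d - a))"
    unfolding splitx[of g] splita[of "\<lambda>a b. g a b - h a b"] sum_quads_diff_right sum_quads_diff_left
      less greater sum_quads_eq_right diag sum_quads_eq_left by (simp add: algebra_simps)
  moreover have "(\<Sum>(a, b, x, y) \<in> quads n. g a b - h a b) =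
      (\<Sum>(a, b, x, y) \<in> quads n. g a b) - (\<Sum>(a, b, x, y) \<in> quads n. h a b)"
    by (simp add: case_prod_unfold sum_subtractf)
  ultimately show ?thesis by (simp add: algebra_simps)
qed

text \<open>If the diagonal value is \<open>d * r d\<close>, then its multiple by
  \<open>n div d\<close> is \<open>n * r d\<close>, which later becomes a derivative of a divisor
  sum series; the rest goes into \<open>p\<close>.\<close>

lemma sum_divisors_quads_telescope:
  fixes g h :: "nat \<Rightarrow> nat \<Rightarrow> complex"
  assumes g_commute: "\<And>a b. g a b = g b a" and h_commute: "\<And>a b. h a b = h b a"
      and diff: "\<And>a c. g a (a + c) - g a c = h a (a + c)"
      and val: "\<And>d. 0 < d \<Longrightarrow> (\<Sum>a\<in>{1..<d}. g a (d - a)) + (g d d - h d d) = p d"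
      and diag: "\<And>d. 0 < d \<Longrightarrow> g d d - h d d = of_nat d * r d"
  shows "(\<Sum>(a, b, x, y) \<in> quads n. h a b) = (\<Sum>d\<in>divisors n. p d - of_nat n * r d)"
proof -
  have "(\<Sum>(a, b, x, y) \<in> quads n. h a b) =
    (\<Sum>d\<in>divisors n. (\<Sum>a\<in>{1..<d}. g a (d - a)) - of_nat (n div d - 1) * (g d d - h d d))"
    by (simp add: sum_quads_telescope[OF g_commute h_commute diff] sum_subtractf)
  also have "\<dots> = (\<Sum>d\<in>divisors n. p d - of_nat n * r d)"
  proof (rule sum.cong)
    fix d assume "d \<in> divisors n"
    then obtain k where d: "0 < d" and n: "n = d * k" and k: "1 \<le> k"
      by (auto simp: divisors_def elim!: dvdE)
    have "of_nat (n div d - 1) * (g d d - h d d) = of_nat n * r d - (g d d - h d d)"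
      using d k by (simp add: n of_nat_diff diag algebra_simps)
    then show "(\<Sum>a\<in>{1..<d}. g a (d - a)) - of_nat (n div d - 1) * (g d d - h d d)
                 = p d - of_nat n * r d"
      using val[OF d] by (simp only:) (simp add: algebra_simps)
  qed simp
  finally show ?thesis .
qed

section \<open>Power sums and closed forms of four convolution sums\<close>

lemma sum_polynomial_deg6:
  fixes c0 c1 c2 c3 c4 c5 c6 :: complex
  assumes "0 < d"
  defines "D \<equiv> of_nat d :: complex"
  shows "(\<Sum>a\<in>{1..<d}. c0 + c1 * of_nat a + c2 * of_nat a ^ 2 + c3 * of_nat a ^ 3 + c4 * of_nat a ^ 4
            + c5 * of_nat a ^ 5 + c6 * of_nat a ^ 6) =
         c0 * (D - 1) + c1 * ((D^2 - D) / 2) + c2 * ((2*D^3 - 3*D^2 + D) / 6)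
         + c3 * ((D^4 - 2*D^3 + D^2) / 4) + c4 * ((6*D^5 - 15*D^4 + 10*D^3 - D) / 30)
         + c5 * ((2*D^6 - 6*D^5 + 5*D^4 - D^2) / 12)
         + c6 * ((6*D^7 - 21*D^6 + 21*D^5 - 7*D^3 + D) / 42)"
proof -
  have 1: "(\<Sum>a\<in>{1..<d}. of_nat a) = (D^2 - D) / 2"
    using assms(1) unfolding D_def by (induction d rule: nat_induct_non_zero) (simp_all add: field_simps eval_nat_numeral)
  have 2: "(\<Sum>a\<in>{1..<d}. of_nat a ^ 2) = (2*D^3 - 3*D^2 + D) / 6"
    using assms(1) unfolding D_def by (induction d rule: nat_induct_non_zero) (simp_all add: field_simps eval_nat_numeral)
  have 3: "(\<Sum>a\<in>{1..<d}. of_nat a ^ 3) = (D^4 - 2*D^3 + D^2) / 4"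
    using assms(1) unfolding D_def by (induction d rule: nat_induct_non_zero) (simp_all add: field_simps eval_nat_numeral)
  have 4: "(\<Sum>a\<in>{1..<d}. of_nat a ^ 4) = (6*D^5 - 15*D^4 + 10*D^3 - D) / 30"
    using assms(1) unfolding D_def by (induction d rule: nat_induct_non_zero) (simp_all add: field_simps eval_nat_numeral)
  have 5: "(\<Sum>a\<in>{1..<d}. of_nat a ^ 5) = (2*D^6 - 6*D^5 + 5*D^4 - D^2) / 12"
    using assms(1) unfolding D_def by (induction d rule: nat_induct_non_zero) (simp_all add: field_simps eval_nat_numeral)
  have 6: "(\<Sum>a\<in>{1..<d}. of_nat a ^ 6) = (6*D^7 - 21*D^6 + 21*D^5 - 7*D^3 + D) / 42"
    using assms(1) unfolding D_def by (induction d rule: nat_induct_non_zero) (simp_all add: field_simps eval_nat_numeral)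
  show ?thesis
    using assms(1) by (simp only: sum.distrib 1 2 3 4 5 6 flip: sum_distrib_left) (simp add: D_def of_nat_diff)
qed

lemma sum_quads_1_1:
  "(\<Sum>(a, b, x, y) \<in> quads n. of_nat a * of_nat b :: complex) =
   (\<Sum>d\<in>divisors n. (5 * of_nat d ^ 3 + of_nat d) / 12 - of_nat n * (of_nat d / 2))"
proof -
  \<comment> \<open>The witness solves \<open>g a (a + c) - g a c = a * (a + c)\<close> among
    symmetric quadratic forms; the later witnesses are likewise symmetric forms of the same degree
    as \<open>h\<close>.\<close>
  let ?g = "\<lambda>a b :: nat. (of_nat a ^ 2 + of_nat a * of_nat b + of_nat b ^ 2) / 2 :: complex"
  show ?thesis
  proof (rule sum_divisors_quads_telescope[where g = ?g])
    show "?g a b = ?g b a" "?g a (a + c) - ?g a c = of_nat a * of_nat (a + c)"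
      "of_nat a * of_nat b = (of_nat b * of_nat a :: complex)"
      "?g d d - of_nat d * of_nat d = of_nat d * (of_nat d / 2)" for a b c d
      by (simp_all add: field_simps power2_eq_square)
    fix d :: nat assume d: "0 < d"
    let ?D = "of_nat d :: complex"
    have "(\<Sum>a\<in>{1..<d}. ?g a (d - a)) = (\<Sum>a\<in>{1..<d}. ?D^2/2 + (- ?D/2) * of_nat a + (1/2) * of_nat a ^ 2
            + 0 * of_nat a ^ 3 + 0 * of_nat a ^ 4 + 0 * of_nat a ^ 5 + 0 * of_nat a ^ 6)"
      by (rule sum.cong) (auto simp: of_nat_diff field_simps power2_eq_square)
    note S = trans[OF this sum_polynomial_deg6[OF d]]
    show "(\<Sum>a\<in>{1..<d}. ?g a (d - a)) + (?g d d - ?D * ?D) = (5 * ?D ^ 3 + ?D) / 12"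
      unfolding S by (simp add: field_simps eval_nat_numeral)
  qed
qed

text \<open>The weight is symmetrized because telescoping needs \<open>h a b = h b a\<close>. The
  witness is the square of the one for \<open>a * b\<close>.\<close>

lemma sum_quads_1_3:
  "(\<Sum>(a, b, x, y) \<in> quads n. of_nat a * of_nat b ^ 3 + of_nat a ^ 3 * of_nat b :: complex) =
   (\<Sum>d\<in>divisors n. (21 * of_nat d ^ 5 + 10 * of_nat d ^ 3 - of_nat d) / 120 - of_nat n * (of_nat d ^ 3 / 4))"
proof -
  let ?g = "\<lambda>a b :: nat. (of_nat a ^ 2 + of_nat a * of_nat b + of_nat b ^ 2) ^ 2 / 4 :: complex"
  let ?h = "\<lambda>a b :: nat. of_nat a * of_nat b ^ 3 + of_nat a ^ 3 * of_nat b :: complex"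
  show ?thesis
  proof (rule sum_divisors_quads_telescope[where g = ?g and h = ?h])
    show "?g a b = ?g b a" "?h a b = ?h b a"
      "?g d d - ?h d d = of_nat d * (of_nat d ^ 3 / 4)" for a b d
      by (simp_all add: field_simps eval_nat_numeral)
    show "?g a (a + c) - ?g a c = ?h a (a + c)" for a c
      by (simp add: field_simps eval_nat_numeral)
    fix d :: nat assume d: "0 < d"
    let ?D = "of_nat d :: complex"
    have "(\<Sum>a\<in>{1..<d}. ?g a (d - a)) = (\<Sum>a\<in>{1..<d}. ?D^4/4 + (-(?D^3)/2) * of_nat a + (3*?D^2/4) * of_nat a ^ 2
            + (- ?D/2) * of_nat a ^ 3 + (1/4) * of_nat a ^ 4 + 0 * of_nat a ^ 5 + 0 * of_nat a ^ 6)"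
      by (rule sum.cong) (auto simp: of_nat_diff field_simps eval_nat_numeral)
    note S = trans[OF this sum_polynomial_deg6[OF d]]
    show "(\<Sum>a\<in>{1..<d}. ?g a (d - a)) + (?g d d - ?h d d) = (21 * ?D ^ 5 + 10 * ?D ^ 3 - ?D) / 120"
      unfolding S by (simp add: field_simps eval_nat_numeral)
  qed
qed

text \<open>\<open>g\<close> and \<open>h\<close> agree on \<open>a = b\<close>, so \<open>r\<close>
  is 0 and \<open>sigma_fps_3_3\<close> has no derivative term. This is the identity behind
  \<open>E4^2 = E8\<close>.\<close>

lemma sum_quads_3_3:
  "(\<Sum>(a, b, x, y) \<in> quads n. of_nat a ^ 3 * of_nat b ^ 3 :: complex) =
   (\<Sum>d\<in>divisors n. (of_nat d ^ 7 - of_nat d ^ 3) / 120 - of_nat n * 0)"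
proof -
  let ?g = "\<lambda>a b :: nat. of_nat a ^ 2 * of_nat b ^ 2 * (of_nat a + of_nat b) ^ 2 / 4 :: complex"
  let ?h = "\<lambda>a b :: nat. of_nat a ^ 3 * of_nat b ^ 3 :: complex"
  show ?thesis
  proof (rule sum_divisors_quads_telescope[where g = ?g and h = ?h])
    show "?g a b = ?g b a" "?h a b = ?h b a"
      "?g d d - ?h d d = of_nat d * 0" for a b d
      by (simp_all add: field_simps eval_nat_numeral)
    show "?g a (a + c) - ?g a c = ?h a (a + c)" for a c
      by (simp add: field_simps eval_nat_numeral)
    fix d :: nat assume d: "0 < d"
    let ?D = "of_nat d :: complex"
    have "(\<Sum>a\<in>{1..<d}. ?g a (d - a)) = (\<Sum>a\<in>{1..<d}. 0 + 0 * of_nat a + (?D^4/4) * of_nat a ^ 2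
            + (-(?D^3)/2) * of_nat a ^ 3 + (?D^2/4) * of_nat a ^ 4 + 0 * of_nat a ^ 5 + 0 * of_nat a ^ 6)"
      by (rule sum.cong) (auto simp: of_nat_diff field_simps eval_nat_numeral)
    note S = trans[OF this sum_polynomial_deg6[OF d]]
    show "(\<Sum>a\<in>{1..<d}. ?g a (d - a)) + (?g d d - ?h d d) = (?D ^ 7 - ?D ^ 3) / 120"
      unfolding S by (simp add: field_simps eval_nat_numeral)
  qed
qed

lemma sum_quads_1_5:
  "(\<Sum>(a, b, x, y) \<in> quads n. of_nat a * of_nat b ^ 5 + of_nat a ^ 5 * of_nat b :: complex) =
   (\<Sum>d\<in>divisors n. (20 * of_nat d ^ 7 + 21 * of_nat d ^ 5 + of_nat d) / 252 - of_nat n * (of_nat d ^ 5 / 6))"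
proof -
  let ?g = "\<lambda>a b :: nat. (2 * of_nat a ^ 6 + 6 * of_nat a ^ 5 * of_nat b + 5 * of_nat a ^ 4 * of_nat b ^ 2
      + 5 * of_nat a ^ 2 * of_nat b ^ 4 + 6 * of_nat a * of_nat b ^ 5 + 2 * of_nat b ^ 6) / 12 :: complex"
  let ?h = "\<lambda>a b :: nat. of_nat a * of_nat b ^ 5 + of_nat a ^ 5 * of_nat b :: complex"
  show ?thesis
  proof (rule sum_divisors_quads_telescope[where g = ?g and h = ?h])
    show "?g a b = ?g b a" "?h a b = ?h b a"
      "?g d d - ?h d d = of_nat d * (of_nat d ^ 5 / 6)" for a b d
      by (simp_all add: field_simps eval_nat_numeral)
    show "?g a (a + c) - ?g a c = ?h a (a + c)" for a c
      by (simp add: field_simps eval_nat_numeral)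
    fix d :: nat assume d: "0 < d"
    let ?D = "of_nat d :: complex"
    have "(\<Sum>a\<in>{1..<d}. ?g a (d - a)) = (\<Sum>a\<in>{1..<d}. ?D^6/6 + (-(?D^5)/2) * of_nat a + (5*?D^4/12) * of_nat a ^ 2
            + 0 * of_nat a ^ 3 + (5*?D^2/12) * of_nat a ^ 4 + (- ?D/2) * of_nat a ^ 5 + (1/6) * of_nat a ^ 6)"
      by (rule sum.cong) (auto simp: of_nat_diff field_simps eval_nat_numeral)
    note S = trans[OF this sum_polynomial_deg6[OF d]]
    show "(\<Sum>a\<in>{1..<d}. ?g a (d - a)) + (?g d d - ?h d d) = (20 * ?D ^ 7 + 21 * ?D ^ 5 + ?D) / 252"
      unfolding S by (simp add: field_simps eval_nat_numeral)
  qed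
qed

section \<open>Ramanujan's differential equations\<close>

definition sigma_fps :: "nat \<Rightarrow> complex fps" where
  "sigma_fps k = Abs_fps (\<lambda>n. \<Sum>d\<in>divisors n. of_nat d ^ k)"

text \<open>A divisor \<open>a\<close> of \<open>m\<close> and a divisor \<open>b\<close> of
  \<open>n - m\<close> have cofactors \<open>x\<close> and \<open>y\<close>, which turns the Cauchy
  product into a sum over \<open>quads n\<close>.\<close>

lemma sigma_fps_mult_nth:
  "(sigma_fps i * sigma_fps j) $ n = (\<Sum>(a, b, x, y) \<in> quads n. of_nat a ^ i * of_nat b ^ j)"
proof -
  have "(sigma_fps i * sigma_fps j) $ n =
     (\<Sum>m\<in>{0..n}. \<Sum>(a, b)\<in>divisors m \<times> divisors (n - m). of_nat a ^ i * of_nat b ^ j)"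
    by (simp add: sigma_fps_def fps_mult_nth sum_product sum.cartesian_product)
  also have "\<dots> = (\<Sum>(m, a, b)\<in>Sigma {0..n} (\<lambda>m. divisors m \<times> divisors (n - m)).
                      of_nat a ^ i * of_nat b ^ j)"
    by (subst sum.Sigma) (auto simp: case_prod_unfold)
  also have "\<dots> = (\<Sum>(a, b, x, y) \<in> quads n. of_nat a ^ i * of_nat b ^ j)"
    by (rule sum.reindex_bij_witness[of _ "\<lambda>(a, b, x, y). (a * x, a, b)"
             "\<lambda>(m, a, b). (a, b, m div a, (n - m) div b)"])
       (auto simp: quads_def divisors_def intro: Suc_leI)
  finally show ?thesis .
qed

lemma numeral_mult_fps_nth: "(numeral k * f) $ n = numeral k * (f $ n :: complex)"
  by (simp add: numeral_fps_const)

text \<open>The Euler operator \<open>q d/dq\<close>.\<close>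

definition qdiff :: "complex fps \<Rightarrow> complex fps" where
  "qdiff F = fps_X * fps_deriv F"

lemma qdiff_nth [simp]: "qdiff F $ n = of_nat n * F $ n"
  by (cases n) (simp_all add: qdiff_def)

lemma sigma_fps_nth: "sigma_fps k $ n = (\<Sum>d\<in>divisors n. of_nat d ^ k)"
  by (simp add: sigma_fps_def)

lemma sigma_fps_1_1:
  "12 * (sigma_fps 1 * sigma_fps 1) = 5 * sigma_fps 3 + sigma_fps 1 - 6 * qdiff (sigma_fps 1)"
proof (rule fps_ext)
  fix n
  have "(sigma_fps 1 * sigma_fps 1) $ n =
      (5 * sigma_fps 3 $ n + sigma_fps 1 $ n) / 12 - of_nat n * (sigma_fps 1 $ n / 2)"
    unfolding sigma_fps_mult_nth power_one_right sum_quads_1_1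
    by (simp add: sigma_fps_nth sum.distrib sum_subtractf case_prod_unfold
        flip: sum_distrib_left sum_divide_distrib)
  then show "(12 * (sigma_fps 1 * sigma_fps 1)) $ n =
      (5 * sigma_fps 3 + sigma_fps 1 - 6 * qdiff (sigma_fps 1)) $ n"
    by (simp only: numeral_mult_fps_nth fps_add_nth fps_sub_nth qdiff_nth) (simp add: algebra_simps)
qed

lemma sigma_fps_3_3: "120 * (sigma_fps 3 * sigma_fps 3) = sigma_fps 7 - sigma_fps 3"
proof (rule fps_ext)
  fix n
  have "(sigma_fps 3 * sigma_fps 3) $ n = (sigma_fps 7 $ n - sigma_fps 3 $ n) / 120"
    unfolding sigma_fps_mult_nth sum_quads_3_3
    by (simp add: sigma_fps_nth sum_subtractf flip: sum_divide_distrib)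
  then show "(120 * (sigma_fps 3 * sigma_fps 3)) $ n = (sigma_fps 7 - sigma_fps 3) $ n"
    by (simp only: numeral_mult_fps_nth fps_sub_nth) simp
qed

lemma sigma_fps_1_3:
  "240 * (sigma_fps 1 * sigma_fps 3) =
     21 * sigma_fps 5 + 10 * sigma_fps 3 - 30 * qdiff (sigma_fps 3) - sigma_fps 1"
proof (rule fps_ext)
  fix n
  \<comment> \<open>The convolution sum is known only in symmetrized form, so the commutative
    product is taken twice.\<close>
  have "2 * (sigma_fps 1 * sigma_fps 3) $ n =
      (sigma_fps 1 * sigma_fps 3) $ n + (sigma_fps 3 * sigma_fps 1) $ n"
    by (simp add: mult.commute)
  also have "\<dots> =
      (21 * sigma_fps 5 $ n + 10 * sigma_fps 3 $ n - sigma_fps 1 $ n) / 120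
      - of_nat n * (sigma_fps 3 $ n / 4)"
    unfolding sigma_fps_mult_nth using sum_quads_1_3[of n]
    by (simp add: sigma_fps_nth sum.distrib sum_subtractf case_prod_unfold
        flip: sum_distrib_left sum_divide_distrib)
  finally show "(240 * (sigma_fps 1 * sigma_fps 3)) $ n =
      (21 * sigma_fps 5 + 10 * sigma_fps 3 - 30 * qdiff (sigma_fps 3) - sigma_fps 1) $ n"
    by (simp only: numeral_mult_fps_nth fps_add_nth fps_sub_nth qdiff_nth) (simp add: algebra_simps)
qed

lemma sigma_fps_1_5:
  "504 * (sigma_fps 1 * sigma_fps 5) =
     20 * sigma_fps 7 + 21 * sigma_fps 5 - 42 * qdiff (sigma_fps 5) + sigma_fps 1"
proof (rule fps_ext)
  fix n
  have "2 * (sigma_fps 1 * sigma_fps 5) $ n =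
      (sigma_fps 1 * sigma_fps 5) $ n + (sigma_fps 5 * sigma_fps 1) $ n"
    by (simp add: mult.commute)
  also have "\<dots> =
      (20 * sigma_fps 7 $ n + 21 * sigma_fps 5 $ n + sigma_fps 1 $ n) / 252
      - of_nat n * (sigma_fps 5 $ n / 6)"
    unfolding sigma_fps_mult_nth using sum_quads_1_5[of n]
    by (simp add: sigma_fps_nth sum.distrib sum_subtractf case_prod_unfold
        flip: sum_distrib_left sum_divide_distrib)
  finally show "(504 * (sigma_fps 1 * sigma_fps 5)) $ n =
      (20 * sigma_fps 7 + 21 * sigma_fps 5 - 42 * qdiff (sigma_fps 5) + sigma_fps 1) $ n"
    by (simp only: numeral_mult_fps_nth fps_add_nth fps_sub_nth qdiff_nth) (simp add: algebra_simps)
qed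

definition "E2_fps = 1 - 24 * sigma_fps 1"
definition "E4_fps = 1 + 240 * sigma_fps 3"
definition "E6_fps = 1 - 504 * sigma_fps 5"

lemma qdiff_derivation:
  "qdiff (F + G) = qdiff F + qdiff G" "qdiff (F - G) = qdiff F - qdiff G"
  "qdiff (F * G) = F * qdiff G + qdiff F * G" "qdiff 1 = 0" "qdiff (numeral k) = 0"
  by (simp_all add: qdiff_def algebra_simps)

text \<open>Expanded, these are linear combinations of the convolution identities. In the third one,
  \<open>sigma_fps 7\<close> cancels between \<open>E2_fps * E6_fps\<close> and
  \<open>E4_fps ^ 2\<close>.\<close>

theorem ramanujan_ode:
  "12 * qdiff E2_fps = E2_fps ^ 2 - E4_fps"
  "3 * qdiff E4_fps = E2_fps * E4_fps - E6_fps"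
  "2 * qdiff E6_fps = E2_fps * E6_fps - E4_fps ^ 2"
  using sigma_fps_1_1 sigma_fps_1_3 sigma_fps_3_3 sigma_fps_1_5
  unfolding E2_fps_def E4_fps_def E6_fps_def qdiff_derivation
  by algebra+

section \<open>The hypergeometric equation\<close>

text \<open>A separate name lets \<open>algebra\<close> treat the inverse as an indeterminate
  subject to \<open>W_fps_mult\<close>.\<close>

definition W_fps :: "complex fps" where "W_fps = inverse E6_fps"

lemma E_fps_nth_0: "E2_fps $ 0 = 1" "E4_fps $ 0 = 1" "E6_fps $ 0 = 1"
  by (simp_all add: E2_fps_def E4_fps_def E6_fps_def sigma_fps_nth divisors_def numeral_mult_fps_nth)

lemma W_fps_mult: "W_fps * E6_fps = 1"
  unfolding W_fps_def by (rule inverse_mult_eq_1) (simp add: E_fps_nth_0)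

lemma E4_fps_inverse_mult: "inverse E4_fps * E4_fps = 1"
  by (rule inverse_mult_eq_1) (simp add: E_fps_nth_0)

text \<open>On functions of \<open>q\<close>, \<open>theta\<close> is the Euler operator \<open>t d/dt\<close> for \<open>t = 1/J\<close>, see \<open>theta_Jinv\<close>.\<close>

definition theta :: "complex fps \<Rightarrow> complex fps" where
  "theta F = E4_fps * W_fps * qdiff F"

text \<open>The series of \<open>1/J\<close>. \<open>J\<close> itself has a pole at
  \<open>q = 0\<close>, while the constant term 0 of \<open>1/J\<close> allows composition with
  it.\<close>

definition Jinv_fps :: "complex fps" where
  "Jinv_fps = 1 - E6_fps ^ 2 * inverse E4_fps ^ 3"

lemma theta_derivation:
  "theta (F + G) = theta F + theta G" "theta (F - G) = theta F - theta G"
  "theta (F * G) = F * theta G + theta F * G" "theta 1 = 0" "theta (numeral k) = 0"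
  by (simp_all add: theta_def qdiff_derivation algebra_simps)

lemma theta_power2: "theta (F ^ 2) = 2 * F * theta F"
  by (simp add: power2_eq_square theta_derivation)

lemma theta_power3: "theta (F ^ 3) = 3 * F ^ 2 * theta F"
  by (simp add: power3_eq_cube power2_eq_square theta_derivation algebra_simps)

lemma theta_E2: "12 * theta E2_fps = E4_fps * W_fps * (E2_fps ^ 2 - E4_fps)"
  and theta_E4: "3 * theta E4_fps = E4_fps * W_fps * (E2_fps * E4_fps - E6_fps)"
  and theta_E6: "2 * theta E6_fps = E4_fps * W_fps * (E2_fps * E6_fps - E4_fps ^ 2)"
  unfolding theta_def ramanujan_ode [symmetric] by (simp_all add: algebra_simps)

lemma theta_W: "theta W_fps = - (W_fps ^ 2) * theta E6_fps"
proof -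
  have "W_fps * theta E6_fps + theta W_fps * E6_fps = 0"
    using theta_derivation(3)[of W_fps E6_fps] by (simp add: W_fps_mult theta_derivation)
  with W_fps_mult show ?thesis by algebra
qed

lemma theta_inverse_E4: "theta (inverse E4_fps) = - (inverse E4_fps ^ 2) * theta E4_fps"
proof -
  have "inverse E4_fps * theta E4_fps + theta (inverse E4_fps) * E4_fps = 0"
    using theta_derivation(3)[of "inverse E4_fps" E4_fps]
    by (simp add: E4_fps_inverse_mult theta_derivation)
  with E4_fps_inverse_mult show ?thesis by algebra
qed

text \<open>On the field generated by the Eisenstein series, the logarithmic derivative of \<open>\<surd>E\<^sub>4\<close> is
  \<open>(u - 1)/6\<close>, and \<open>u\<close>, \<open>v\<close> generate a ring closed under \<open>theta\<close>.\<close>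

definition "u_fps = E2_fps * E4_fps * W_fps"
definition "v_fps = E4_fps ^ 3 * W_fps ^ 2"

text \<open>Keeps the denominators of the differential equations out of the polynomial
  computations.\<close>

lemma fps_cancel_numeral: "numeral k * F = numeral k * G \<Longrightarrow> F = (G :: complex fps)"
  by simp

text \<open>The terms with \<open>E2\<close> cancel, since \<open>E6^2\<close> and
  \<open>E4^3\<close> have equal weight. This leaves \<open>q dt/dq = (E6/E4) t\<close>, and the
  factor \<open>E4/E6\<close> in \<open>theta\<close> is chosen to turn it into
  \<open>t\<close>.\<close>

lemma theta_Jinv: "theta Jinv_fps = Jinv_fps"
proof (rule fps_cancel_numeral)
  have "theta Jinv_fps = - (E6_fps ^ 2 * (3 * inverse E4_fps ^ 2 * theta (inverse E4_fps))
     + 2 * E6_fps * theta E6_fps * inverse E4_fps ^ 3)"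
    by (simp add: Jinv_fps_def theta_derivation theta_power2 theta_power3)
  then show "6 * theta Jinv_fps = 6 * Jinv_fps"
    using theta_inverse_E4 theta_E4 theta_E6 E4_fps_inverse_mult W_fps_mult
    unfolding Jinv_fps_def by algebra
qed

lemma theta_v: "theta v_fps = v_fps ^ 2 - v_fps"
proof (rule fps_cancel_numeral)
  have "theta v_fps = E4_fps ^ 3 * (2 * W_fps * theta W_fps) + 3 * E4_fps ^ 2 * theta E4_fps * W_fps ^ 2"
    by (simp add: v_fps_def theta_derivation theta_power2 theta_power3)
  then show "6 * theta v_fps = 6 * (v_fps ^ 2 - v_fps)"
    using theta_W theta_E4 theta_E6 W_fps_mult unfolding v_fps_def by algebra
qed

lemma theta_u: "12 * theta u_fps = 6 * u_fps * v_fps - u_fps ^ 2 - 4 * u_fps - v_fps"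
proof -
  have "theta u_fps = E2_fps * E4_fps * theta W_fps
      + (E2_fps * theta E4_fps + theta E2_fps * E4_fps) * W_fps"
    by (simp add: u_fps_def theta_derivation)
  then show ?thesis
    using theta_W theta_E2 theta_E4 theta_E6 W_fps_mult unfolding u_fps_def v_fps_def by algebra
qed

text \<open>So \<open>v_fps\<close> is \<open>1/(1 - t) = J/(J - 1)\<close>, the quantity under the
  square root of the theorem.\<close>

lemma one_minus_Jinv_mult_v: "(1 - Jinv_fps) * v_fps = 1"
  using E4_fps_inverse_mult W_fps_mult unfolding Jinv_fps_def v_fps_def by algebra

lemma theta_sqrt_E4:
  assumes "f ^ 2 = E4_fps"
  shows "6 * theta f = f * (u_fps - 1)"
proof -
  have "f \<noteq> 0" using assms E_fps_nth_0(2) by auto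
  have "6 * f * theta f = 3 * theta E4_fps"
    using theta_power2[of f] by (simp add: assms)
  also have "\<dots> = f * (f * (u_fps - 1))"
    unfolding theta_E4 u_fps_def using W_fps_mult assms by algebra
  finally show ?thesis using \<open>f \<noteq> 0\<close>
    by (metis (no_types, lifting) mult.left_commute mult_left_cancel mult.assoc)
qed

text \<open>Expanded form of \<open>72 D^3 - t (6 D + 1) (2 D + 1) (6 D + 5)\<close> with
  \<open>D = theta\<close>, the operator of the 3F2 series with upper parameters 1/6, 1/2, 5/6 and
  lower parameters 1, 1.\<close>

definition hypergeom_defect :: "complex fps \<Rightarrow> complex fps" where
  "hypergeom_defect F = 72 * theta (theta (theta F))
      - Jinv_fps * (72 * theta (theta (theta F)) + 108 * theta (theta F) + 46 * theta F + 5 * F)"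

text \<open>Each derivative of \<open>f\<close> is \<open>f\<close> times a polynomial in
  \<open>u_fps\<close> and \<open>v_fps\<close>, so the equation reduces to a polynomial identity
  and \<open>v_fps = 1/(1 - t)\<close>.\<close>

lemma hypergeom_defect_sqrt_E4:
  assumes "f ^ 2 = E4_fps"
  shows "hypergeom_defect f = 0"
proof -
  define a b c where "a = theta f" and "b = theta a" and "c = theta b"
  \<comment> \<open>This is \<open>2 (u - 1)^2 + 12 theta u\<close> with \<open>theta_u\<close>
    inserted.\<close>
  let ?p = "u_fps ^ 2 - 8 * u_fps + 6 * u_fps * v_fps - v_fps + 2"
  have a: "6 * a = f * (u_fps - 1)"
    using theta_sqrt_E4[OF assms] by (simp add: a_def)
  have "6 * b = f * theta u_fps + a * (u_fps - 1)"
    using arg_cong[OF a, of theta] by (simp add: theta_derivation b_def a_def)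
  then have b: "72 * b = f * ?p"
    using a theta_u by algebra
  have "72 * c = f * (2 * u_fps * theta u_fps - 8 * theta u_fps
      + 6 * (u_fps * theta v_fps + theta u_fps * v_fps) - theta v_fps) + a * ?p"
    using arg_cong[OF b, of theta]
    by (simp add: theta_derivation theta_power2 c_def b_def a_def algebra_simps)
  then have c: "432 * c = f * (?p * (u_fps - 1) + (u_fps - 4 + 3 * v_fps) * 12 * theta u_fps 
     + 36 * u_fps * theta v_fps - 6 * theta v_fps)"
    using a by algebra
  have c': "432 * c = f * ((v_fps - 1) * (9 * u_fps ^ 2 - 26 * u_fps + 54 * u_fps * v_fps
       - 9 * v_fps + 2))"
    unfolding c using theta_u theta_v by algebra
  have "6 * (72 * c) = 6 * ((v_fps - 1) * (108 * b + 46 * a + 5 * f))"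
    using a b c' by algebra
  then have "72 * c = (v_fps - 1) * (108 * b + 46 * a + 5 * f)"
    by (rule fps_cancel_numeral)
  \<comment> \<open>Multiplication by \<open>1 - t\<close> uses
    \<open>(1 - t) * (v_fps - 1) = t\<close>.\<close>
  then have "72 * c - Jinv_fps * (72 * c + 108 * b + 46 * a + 5 * f) = 0"
    using one_minus_Jinv_mult_v by algebra
  then show ?thesis by (simp add: hypergeom_defect_def a_def b_def c_def)
qed

lemma Jinv_fps_nth_0: "Jinv_fps $ 0 = 0"
  by (simp add: Jinv_fps_def E_fps_nth_0 fps_nth_power_0)

text \<open>\<open>E4_fps * W_fps\<close> has constant term 1, so on the lowest coefficient
  \<open>theta\<close> acts like the Euler operator.\<close>

lemma theta_nth_order:
  assumes "\<And>i. i < m \<Longrightarrow> F $ i = 0"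
  shows "theta F $ m = of_nat m * F $ m" "\<And>i. i < m \<Longrightarrow> theta F $ i = 0"
proof -
  have *: "theta F $ i = of_nat i * F $ i" if "i \<le> m" for i
  proof -
    have "theta F $ i = (\<Sum>j=0..i. (E4_fps * W_fps) $ j * qdiff F $ (i - j))"
      unfolding theta_def by (rule fps_mult_nth)
    also have "\<dots> = (\<Sum>j\<in>{0}. (E4_fps * W_fps) $ j * qdiff F $ (i - j))"
      using assms that by (intro sum.mono_neutral_right) auto
    also have "\<dots> = of_nat i * F $ i"
      by (simp add: E_fps_nth_0 W_fps_def)
    finally show ?thesis .
  qed
  then show "theta F $ m = of_nat m * F $ m" by simp
  show "theta F $ i = 0" if "i < m" for i
    using *[of i] assms[of i] that by simp
qed

text \<open>The lowest coefficient of \<open>F\<close>, in degree \<open>m\<close>, contributes \<open>72 m\<^sup>3\<close> times itself to the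
  equation, since multiplication by \<open>t\<close> raises the order.\<close>

lemma hypergeom_defect_unique:
  assumes "hypergeom_defect F = 0" "F $ 0 = 0"
  shows "F = 0"
proof (rule fps_ext)
  fix n show "F $ n = 0 $ n"
  proof (induction n rule: less_induct)
    case (less m)
    then have F: "F $ i = 0" if "i < m" for i using that by simp
    note F1 = theta_nth_order[OF F, of m]
    note F2 = theta_nth_order[of m, OF F1(2)]
    note F3 = theta_nth_order[of m, OF F2(2)]
    have t: "(Jinv_fps * G) $ m = 0" if "\<And>i. i < m \<Longrightarrow> G $ i = 0" for G
      unfolding fps_mult_nth
    proof (intro sum.neutral ballI)
      fix j assume "j \<in> {0..m}"
      then show "Jinv_fps $ j * G $ (m - j) = 0"
        using that[of "m - j"] Jinv_fps_nth_0 by (cases "j = 0") auto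
    qed
    have "0 = hypergeom_defect F $ m" using assms by simp
    also have "\<dots> = 72 * of_nat m ^ 3 * F $ m"
      unfolding hypergeom_defect_def fps_sub_nth
      using t[of "72 * theta (theta (theta F)) + 108 * theta (theta F) + 46 * theta F + 5 * F"] F F1 F2 F3
      by (simp add: numeral_mult_fps_nth power3_eq_cube)
    \<comment> \<open>The factor \<open>m ^ 3\<close> vanishes only at \<open>m = 0\<close>, where
      the hypothesis on the constant term applies.\<close>
    finally show ?case using assms(2) by (cases "m = 0") auto
  qed
qed

section \<open>The hypergeometric series\<close>

definition ramanujan_coeff :: "nat \<Rightarrow> complex" where
  "ramanujan_coeff n = of_nat (fact (6 * n)) / (of_nat (fact (3 * n)) * of_nat (fact n) ^ 3) / 1728 ^ n"

definition ramanujan_fps :: "complex fps" where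
  "ramanujan_fps = Abs_fps ramanujan_coeff"

text \<open>Of the six new factors in \<open>fact (6 * n + 6)\<close>, the even ones are twice those
  of \<open>fact (3 * n + 3)\<close>, and \<open>6 * n + 3 = 3 * (2 * n + 1)\<close>. This extracts
  24, and 1728 / 24 = 72.\<close>

lemma ramanujan_coeff_Suc:
  "72 * of_nat (Suc n) ^ 3 * ramanujan_coeff (Suc n) =
     of_nat ((6 * n + 1) * (2 * n + 1) * (6 * n + 5)) * ramanujan_coeff n"
proof -
  define N A B C :: complex where "N = of_nat n" and "A = fact (6 * n)" and "B = fact (3 * n)" and "C = fact n"
  have nz: "B \<noteq> 0" "C \<noteq> 0" by (simp_all add: B_def C_def)
  note fact_simps = fact_Suc of_nat_Suc of_nat_mult of_nat_numeral
      N_def [symmetric] A_def [symmetric] B_def [symmetric]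
  have e6: "6 * Suc n = Suc (Suc (Suc (Suc (Suc (Suc (6 * n))))))"
    and e3: "3 * Suc n = Suc (Suc (Suc (3 * n)))"
    by simp_all
  have f6: "fact (6 * Suc n) = (6*N+6) * (6*N+5) * (6*N+4) * (6*N+3) * (6*N+2) * (6*N+1) * A"
    unfolding e6 fact_simps by algebra
  have f3: "fact (3 * Suc n) = (3*N+3) * (3*N+2) * (3*N+1) * B"
    unfolding e3 fact_simps by algebra
  have f1: "fact (Suc n) = (N+1) * C"
    by (simp add: N_def C_def)
  have "of_nat (Suc k) \<noteq> (0 :: complex)" for k by (rule of_nat_neq_0)
  from this[of n] this[of "3 * n"] this[of "3 * n + 1"] this[of "3 * n + 2"]
  have nz': "N + 1 \<noteq> 0" "3 * N + 1 \<noteq> 0" "3 * N + 2 \<noteq> 0" "3 * N + 3 \<noteq> 0"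
    by (simp_all add: N_def add_ac)
  have "72 * (N + 1) ^ 3 * (((6*N+6) * (6*N+5) * (6*N+4) * (6*N+3) * (6*N+2) * (6*N+1) * A)
       / ((3*N+3) * (3*N+2) * (3*N+1) * B * ((N+1) * C) ^ 3) / (1728 * 1728 ^ n))
    = (6 * N + 1) * (2 * N + 1) * (6 * N + 5) * (A / (B * C ^ 3) / 1728 ^ n)"
  proof -
    have eq: "(6*N+6) * (6*N+5) * (6*N+4) * (6*N+3) * (6*N+2) * (6*N+1) * A =
      (24 * ((3*N+3) * (3*N+2) * (3*N+1))) * ((6 * N + 1) * (2 * N + 1) * (6 * N + 5)) * A"
      by algebra
    have *: "72 * M ^ 3 * (24 * Z * Y * A / (Z * B * (M * C) ^ 3) / (1728 * X))
        = Y * (A / (B * C ^ 3) / X)" if "M \<noteq> 0" "Z \<noteq> 0" "X \<noteq> 0" for M X Y Z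
      using nz that by (simp add: field_simps power_mult_distrib)
    show ?thesis
      unfolding eq by (rule *) (use nz' in simp_all)
  qed
  moreover have "of_nat ((6 * n + 1) * (2 * n + 1) * (6 * n + 5)) = (6 * N + 1) * (2 * N + 1) * (6 * N + 5)"
    "of_nat (Suc n) = N + 1"
    by (simp_all add: N_def algebra_simps)
  ultimately show ?thesis
    by (simp only: ramanujan_coeff_def of_nat_fact f6 f3 f1 A_def [symmetric] B_def [symmetric]
        C_def [symmetric] power_Suc)
qed

lemma ramanujan_fps_ode:
  "72 * qdiff (qdiff (qdiff ramanujan_fps)) = fps_X * (72 * qdiff (qdiff (qdiff ramanujan_fps))
     + 108 * qdiff (qdiff ramanujan_fps) + 46 * qdiff ramanujan_fps + 5 * ramanujan_fps)"
proof (rule fps_ext)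
  fix n
  show "(72 * qdiff (qdiff (qdiff ramanujan_fps))) $ n = (fps_X * (72 * qdiff (qdiff (qdiff ramanujan_fps))
     + 108 * qdiff (qdiff ramanujan_fps) + 46 * qdiff ramanujan_fps + 5 * ramanujan_fps)) $ n"
  proof (cases n)
    case (Suc m)
    have "(of_nat ((6 * m + 1) * (2 * m + 1) * (6 * m + 5)) :: complex) =
       72 * of_nat m ^ 3 + 108 * of_nat m ^ 2 + 46 * of_nat m + 5"
      by (simp add: algebra_simps power3_eq_cube power2_eq_square)
    with ramanujan_coeff_Suc[of m] have "72 * of_nat (Suc m) ^ 3 * ramanujan_fps $ Suc m =
       (72 * of_nat m ^ 3 + 108 * of_nat m ^ 2 + 46 * of_nat m + 5) * ramanujan_fps $ m"
      by (simp only: ramanujan_fps_def fps_nth_Abs_fps)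
    then show ?thesis
      by (simp only: Suc numeral_mult_fps_nth fps_add_nth qdiff_nth fps_X_mult_nth)
         (simp add: power3_eq_cube power2_eq_square algebra_simps del: of_nat_Suc)
  qed (simp add: numeral_mult_fps_nth)
qed

text \<open>By the chain rule and \<open>theta_Jinv\<close>, \<open>theta\<close> is
  \<open>t d/dt\<close> on functions of \<open>t\<close>.\<close>

lemma theta_compose: "theta (F oo Jinv_fps) = qdiff F oo Jinv_fps"
proof -
  have "theta (F oo Jinv_fps) = (fps_deriv F oo Jinv_fps) * theta Jinv_fps"
    by (simp add: theta_def qdiff_def fps_compose_deriv Jinv_fps_nth_0 mult_ac)
  then show ?thesis
    by (simp add: theta_Jinv qdiff_def fps_compose_mult_distrib Jinv_fps_nth_0 mult_ac)
qed

lemma numeral_fps_compose: "numeral k oo (F :: complex fps) = numeral k"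
  by (simp add: numeral_fps_const fps_const_compose)

lemma hypergeom_defect_ramanujan: "hypergeom_defect (ramanujan_fps oo Jinv_fps) = 0"
proof -
  have "(72 * qdiff (qdiff (qdiff ramanujan_fps))) oo Jinv_fps = (fps_X * (72 * qdiff (qdiff (qdiff ramanujan_fps))
     + 108 * qdiff (qdiff ramanujan_fps) + 46 * qdiff ramanujan_fps + 5 * ramanujan_fps)) oo Jinv_fps"
    using ramanujan_fps_ode by (rule arg_cong)
  then show ?thesis
    by (simp add: hypergeom_defect_def theta_compose fps_compose_mult_distrib Jinv_fps_nth_0
      fps_compose_add_distrib numeral_fps_compose)
qed

theorem sqrt_E4_eq_ramanujan:
  assumes "f ^ 2 = E4_fps" "f $ 0 = 1"
  shows "ramanujan_fps oo Jinv_fps = f"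
proof -
  have "hypergeom_defect ((ramanujan_fps oo Jinv_fps) - f) =
          hypergeom_defect (ramanujan_fps oo Jinv_fps) - hypergeom_defect f"
    unfolding hypergeom_defect_def theta_derivation by (simp add: algebra_simps)
  then have "hypergeom_defect ((ramanujan_fps oo Jinv_fps) - f) = 0"
    by (simp add: hypergeom_defect_ramanujan hypergeom_defect_sqrt_E4[OF assms(1)])
  moreover have "((ramanujan_fps oo Jinv_fps) - f) $ 0 = 0"
    using assms(2) by (simp add: ramanujan_fps_def ramanujan_coeff_def)
  ultimately show ?thesis
    using hypergeom_defect_unique by force
qed

section \<open>Lambert series and numerical bounds\<close>

text \<open>Applying \<open>q d/dq\<close> to the geometric series \<open>k\<close> times keeps the
  radius of convergence at least 1.\<close>

lemma summable_power_times_geometric: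
  fixes q :: complex
  assumes "norm q < 1"
  shows "summable (\<lambda>n. norm (of_nat n ^ k * q ^ n))"
proof -
  define G where "G = (qdiff ^^ k) (Abs_fps (\<lambda>_. 1))"
  have "fps_conv_radius ((qdiff ^^ k) (Abs_fps (\<lambda>_. 1))) \<ge> 1"
  proof (induction k)
    case 0
    have "conv_radius (\<lambda>_. 1 :: complex) \<ge> 1"
      by (rule conv_radius_geI_ex') (auto simp: one_ereal_def intro: summable_geometric)
    then show ?case by (simp add: fps_conv_radius_def)
  next
    case (Suc k)
    then show ?case
      using fps_conv_radius_mult[of fps_X "fps_deriv ((qdiff ^^ k) (Abs_fps (\<lambda>_. 1)))"]
        fps_conv_radius_deriv[of "(qdiff ^^ k) (Abs_fps (\<lambda>_. 1 :: complex))"]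
      unfolding funpow.simps comp_def qdiff_def[of "(qdiff ^^ k) _"] by simp
  qed
  then have "ereal (norm q) < fps_conv_radius G"
    using assms unfolding G_def by (metis ereal_less(3) less_le_trans)
  moreover have "fps_nth G n = of_nat n ^ k" for n
    unfolding G_def by (induction k) simp_all
  ultimately show ?thesis
    using abs_summable_in_conv_radius[of q "fps_nth G"] by (simp add: fps_conv_radius_def)
qed

lemma norm_sigma_fps_nth_le: "norm (sigma_fps k $ n) \<le> real n ^ Suc k"
proof -
  have "norm (sigma_fps k $ n) \<le> (\<Sum>d\<in>divisors n. norm (of_nat d ^ k :: complex))"
    unfolding sigma_fps_nth by (rule norm_sum)
  also have "\<dots> \<le> (\<Sum>d\<in>divisors n. real n ^ k)"
    by (intro sum_mono) (auto simp: norm_power divisors_def intro!: power_mono)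
  also have "\<dots> = real (card (divisors n)) * real n ^ k" by simp
  also have "\<dots> \<le> real n * real n ^ k"
    using card_mono[of "{1..n}" "divisors n"] by (intro mult_right_mono) (simp_all add: divisors_def subset_iff)
  finally show ?thesis by simp
qed

lemma fps_conv_radius_sigma_fps: "fps_conv_radius (sigma_fps k) \<ge> 1"
  unfolding fps_conv_radius_def
proof (rule conv_radius_geI_ex')
  fix r :: real assume "0 < r" "ereal r < 1"
  then have *: "norm (of_real r :: complex) < 1" by simp
  show "summable (\<lambda>n. sigma_fps k $ n * of_real r ^ n)"
  proof (rule summable_comparison_test)
    show "summable (\<lambda>n. norm (of_nat n ^ Suc k * of_real r ^ n :: complex))"
      by (rule summable_power_times_geometric[OF *])
    show "\<exists>N. \<forall>n\<ge>N. norm (sigma_fps k $ n * of_real r ^ n)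
              \<le> norm (of_nat n ^ Suc k * of_real r ^ n :: complex)"
      using norm_sigma_fps_nth_le[of k] by (simp add: norm_mult norm_power mult_right_mono)
  qed
qed

lemma norm_less_fps_conv_radius_sigma_fps:
  "norm q < 1 \<Longrightarrow> ereal (norm q) < fps_conv_radius (sigma_fps k)"
  using fps_conv_radius_sigma_fps[of k] by (metis ereal_less(3) less_le_trans)

text \<open>The double series of \<open>d^k q^(d m)\<close> converges absolutely. Summing over
  \<open>m\<close> first gives the Lambert series, grouping by \<open>n = d * m\<close> the power
  series.\<close>

lemma lambert_series_sums:
  fixes q :: complex
  assumes "norm q < 1"
  shows "(\<lambda>n. of_nat (Suc n) ^ k * q ^ Suc n / (1 - q ^ Suc n)) sums eval_fps (sigma_fps k) q"
proof -
  let ?f = "\<lambda>(d, m). of_nat d ^ k * q ^ (d * m)"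
  let ?g = "\<lambda>d. of_nat d ^ k * (q ^ d / (1 - q ^ d))"
  have small: "norm (q ^ d) < 1" if "1 \<le> d" for d
    using assms that by (simp add: norm_power power_less_one_iff)
  have "(\<lambda>z. norm (?f z)) summable_on ({1..} \<times> {1..})"
  proof (rule summable_on_SigmaI)
    fix d :: nat assume "d \<in> {1..}"
    then have "((\<lambda>m. norm (q ^ d) ^ m) has_sum (norm (q ^ d) / (1 - norm (q ^ d)))) {1..}"
      using small[of d] by (intro has_sum_geometric_from_1) auto
    from has_sum_cmult_right[OF this, of "real d ^ k"]
    show "((\<lambda>m. norm (?f (d, m))) has_sum (real d ^ k * (norm (q ^ d) / (1 - norm (q ^ d))))) {1..}"
      by (simp add: norm_mult norm_power power_mult)
  next
    have le: "norm q ^ d \<le> norm q" if "1 \<le> d" for d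
      using power_decreasing[of 1 d "norm q"] that assms by simp
    have "(\<lambda>d. norm (of_nat d ^ k * q ^ d) / (1 - norm q)) summable_on UNIV"
      using summable_power_times_geometric[OF assms, of k] assms
      by (intro norm_summable_imp_summable_on) (simp add: summable_divide)
    then have "(\<lambda>d. norm (of_nat d ^ k * q ^ d) / (1 - norm q)) summable_on {1..}"
      by (rule summable_on_subset_banach) auto
    then show "(\<lambda>d. real d ^ k * (norm (q ^ d) / (1 - norm (q ^ d)))) summable_on {1..}"
      using assms le
      by (elim summable_on_comparison_test)
         (auto simp: norm_mult norm_power divide_nonneg_nonneg power_le_one
           simp flip: times_divide_eq_right intro!: mult_left_mono frac_le)
  qed auto
  then have summable: "?f summable_on ({1..} \<times> {1..})"
    by (rule abs_summable_summable)
  have inner: "((\<lambda>m. ?f (d, m)) has_sum ?g d) {1..}" if "d \<in> {1..}" for d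
    using has_sum_cmult_right[OF has_sum_geometric_from_1[OF small[of d]], of "of_nat d ^ k"] that
    by (simp add: power_mult)
  obtain S where S: "(?f has_sum S) ({1..} \<times> {1..})"
    using summable by (auto simp: summable_on_def)
  have "(?g has_sum S) {1..}"
    by (rule has_sum_SigmaD[OF S inner])
  then have "((\<lambda>n. of_nat (Suc n) ^ k * q ^ Suc n / (1 - q ^ Suc n)) has_sum S) UNIV"
    by (subst (asm) has_sum_reindex_bij_witness[of "{1..}" Suc "\<lambda>n. n - 1" UNIV
          "\<lambda>n. of_nat (Suc n) ^ k * q ^ Suc n / (1 - q ^ Suc n)" ?g S S]) auto
  then have 1: "(\<lambda>n. of_nat (Suc n) ^ k * q ^ Suc n / (1 - q ^ Suc n)) sums S"
    by (rule has_sum_imp_sums)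
  have "((\<lambda>(n, d). of_nat d ^ k * q ^ n) has_sum S) (Sigma {1..} divisors)"
    using S
    by (subst (asm) has_sum_reindex_bij_witness[of "{1..} \<times> {1..}" "\<lambda>(n, d). (d, n div d)" "\<lambda>(d, m). (d * m, d)"
          "Sigma {1..} divisors" "\<lambda>(n, d). of_nat d ^ k * q ^ n" ?f S S])
       (auto simp: divisors_def Suc_le_eq div_greater_zero_iff)
  then have "((\<lambda>n. sigma_fps k $ n * q ^ n) has_sum S) {1..}"
    by (rule has_sum_SigmaD) (auto simp: sigma_fps_nth sum_distrib_right intro!: has_sum_finiteI)
  then have "((\<lambda>n. sigma_fps k $ n * q ^ n) has_sum S) UNIV"
    by (subst (asm) has_sum_cong_neutral[of UNIV "{1..}" _ "\<lambda>n. sigma_fps k $ n * q ^ n"])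
       (auto simp: sigma_fps_nth divisors_def not_le)
  then have "eval_fps (sigma_fps k) q = S"
    unfolding eval_fps_def using has_sum_imp_sums sums_unique by fastforce
  with 1 show ?thesis by simp
qed

text \<open>After the first term \<open>q\<close>, the coefficient bound
  \<open>(n + 2) ^ (k + 1)\<close> is at most \<open>2 ^ (k + 1) * 12 ^ n\<close>, where 12 exceeds
  \<open>(3 / 2) ^ 6\<close>. The geometric series of ratio 12/2500 has sum below 65/64.\<close>

lemma eval_sigma_fps_bound:
  fixes q :: complex
  assumes q: "norm q \<le> 1 / 2500" and k: "k \<le> 5"
  shows "norm (eval_fps (sigma_fps k) q - q) \<le> 65 / 64 * 2 ^ Suc k * norm q ^ 2"
proof -
  let ?c = "\<lambda>n. sigma_fps k $ n * q ^ n"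
  have c: "summable ?c"
    using summable_fps[OF norm_less_fps_conv_radius_sigma_fps[of q k]] q by simp
  have "divisors 0 = {}" "divisors 1 = {1}"
    by (auto simp: divisors_def)
  then have "(\<Sum>n<2. ?c n) = q"
    by (simp add: sigma_fps_nth eval_nat_numeral)
  then have eq: "eval_fps (sigma_fps k) q - q = (\<Sum>n. ?c (n + 2))"
    unfolding eval_fps_def using suminf_split_initial_segment[OF c, of 2] by simp
  have geo: "(\<lambda>n. 2 ^ Suc k * norm q ^ 2 * (12 / 2500) ^ n) sums
               (2 ^ Suc k * norm q ^ 2 * (1 / (1 - 12 / 2500)))"
    by (intro sums_mult geometric_sums) simp
  have bound: "norm (?c (n + 2)) \<le> 2 ^ Suc k * norm q ^ 2 * (12 / 2500) ^ n" for n
  proof -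
    have "real (n + 2) / 2 \<le> (3 / 2) ^ n"
      using Bernoulli_inequality[of "1 / 2 :: real" n] by simp
    then have "(real (n + 2) / 2) ^ Suc k \<le> ((3 / 2) ^ n) ^ Suc k"
      by (intro power_mono) auto
    also have "\<dots> = ((3 / 2) ^ Suc k) ^ n"
      by (simp only: power_mult [symmetric] mult.commute)
    also have "\<dots> \<le> 12 ^ n"
    proof (rule power_mono)
      have "(3 / 2 :: real) ^ Suc k \<le> (3 / 2) ^ 6"
        using k by (intro power_increasing) auto
      also have "\<dots> \<le> 12" by (simp add: eval_nat_numeral)
      finally show "(3 / 2 :: real) ^ Suc k \<le> 12" .
    qed auto
    finally have *: "real (n + 2) ^ Suc k \<le> 2 ^ Suc k * 12 ^ n"
      by (simp add: power_divide field_simps del: power_Suc)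
    have "norm (?c (n + 2)) = norm (sigma_fps k $ (n + 2)) * norm q ^ (n + 2)"
      by (simp only: norm_mult norm_power)
    also have "\<dots> \<le> real (n + 2) ^ Suc k * norm q ^ (n + 2)"
      by (intro mult_right_mono norm_sigma_fps_nth_le) auto
    also have "\<dots> \<le> (2 ^ Suc k * 12 ^ n) * ((1 / 2500) ^ n * norm q ^ 2)"
      unfolding power_add by (intro mult_mono * power_mono q order_refl) auto
    also have "\<dots> = 2 ^ Suc k * norm q ^ 2 * (12 / 2500) ^ n"
      using power_mult_distrib[of "12 :: real" "1 / 2500" n] by simp
    finally show ?thesis .
  qed
  have "norm (\<Sum>n. ?c (n + 2)) \<le> (\<Sum>n. 2 ^ Suc k * norm q ^ 2 * (12 / 2500) ^ n)"
    by (rule norm_suminf_le[OF bound sums_summable[OF geo]])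
  also have "\<dots> = 2 ^ Suc k * norm q ^ 2 * (1 / (1 - 12 / 2500))"
    by (rule sums_unique[OF geo, symmetric])
  also have "\<dots> \<le> 2 ^ Suc k * norm q ^ 2 * (65 / 64)"
    by (intro mult_left_mono) auto
  finally show ?thesis by (simp add: eq mult_ac)
qed

text \<open>This turns \<open>Im \<tau> > 5/4\<close> into \<open>norm q < 1/2500\<close>. The left
  side is about 2576, so the rational bounds must be fairly sharp.\<close>

lemma exp_gt_2500: "exp (5 / 2 * pi) > (2500 :: real)"
proof -
  \<comment> \<open>A rational slightly below \<open>pi / 6 = 0.52359...\<close>; the Taylor bound
    gives \<open>sin x < 1/2\<close>.\<close>
  define x :: real where "x = 2617 / 5000"
  have "x < pi / 6"
  proof (rule ccontr)
    assume "\<not> x < pi / 6"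
    then have "sin (pi / 6) \<le> sin x"
      using pi_ge_two by (intro sin_monotone_2pi_le) (auto simp: x_def)
    moreover have "(\<Sum>m<5. sin_coeff m * x ^ m) = x - x ^ 3 / 6"
    proof -
      have "(\<Sum>m<5. f m) = f 0 + f 1 + f 2 + f 3 + f 4" for f :: "nat \<Rightarrow> real"
        by (simp add: eval_nat_numeral)
      then show ?thesis by (simp add: sin_coeff_def fact_numeral)
    qed
    moreover have "\<bar>sin x - (\<Sum>m<5. sin_coeff m * x ^ m)\<bar> \<le> inverse (fact 5) * \<bar>x\<bar> ^ 5"
      by (rule Maclaurin_sin_bound)
    ultimately show False
      by (simp add: sin_30 x_def fact_numeral abs_le_iff power_divide)
  qed
  then have x: "157 / 160 \<le> 5 / 2 * pi / 8"
    by (simp add: x_def)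
  \<comment> \<open>Taking an eighth of the exponent brings it below 1, where 7 Taylor terms
    suffice; \<open>2.66 ^ 8\<close> is about 2506.\<close>
  have "266 / 100 \<le> (\<Sum>n<7. (157 / 160) ^ n / fact n :: real)"
    by (simp add: eval_nat_numeral)
  also have "\<dots> = (\<Sum>n<7. (157 / 160) ^ n /\<^sub>R fact n)"
    by (simp only: real_scaleR_def divide_inverse_commute)
  also have "\<dots> \<le> exp (157 / 160 :: real)"
    unfolding exp_def by (rule sum_le_suminf[OF summable_exp_generic]) auto
  also have "\<dots> \<le> exp (5 / 2 * pi / 8)"
    using x by simp
  finally have "(266 / 100) ^ 8 \<le> exp (5 / 2 * pi / 8) ^ 8"
    by (rule power_mono) simp
  also have "\<dots> = exp (5 / 2 * pi)"
    by (simp flip: exp_of_nat_mult)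
  finally show ?thesis
    by (rule less_le_trans[rotated]) (simp add: power_divide)
qed

section \<open>Analytic continuation\<close>

text \<open>As functions of \<open>q\<close> instead of \<tau>, the Eisenstein series extend to
  \<open>q = 0\<close> and have Taylor expansions there.\<close>

definition E2q :: "complex \<Rightarrow> complex" where "E2q q = 1 - 24 * eval_fps (sigma_fps 1) q"
definition E4q :: "complex \<Rightarrow> complex" where "E4q q = 1 + 240 * eval_fps (sigma_fps 3) q"
definition E6q :: "complex \<Rightarrow> complex" where "E6q q = 1 - 504 * eval_fps (sigma_fps 5) q"
definition Jinv :: "complex \<Rightarrow> complex" where "Jinv q = 1 - E6q q ^ 2 * inverse (E4q q) ^ 3"

lemma eisenstein_eq_eval:
  assumes "norm (qnome \<tau>) < 1"
  shows "E2 \<tau> = E2q (qnome \<tau>)" "E4 \<tau> = E4q (qnome \<tau>)" "E6 \<tau> = E6q (qnome \<tau>)"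
  using lambert_series_sums[OF assms, of 1] lambert_series_sums[OF assms, of 3]
    lambert_series_sums[OF assms, of 5]
  by (simp_all only: E2_def E4_def E6_def E2q_def E4q_def E6q_def sums_iff power_one_right)

lemma eval_fps_has_fps_expansion_ge_1:
  "fps_conv_radius F \<ge> 1 \<Longrightarrow> eval_fps F has_fps_expansion F"
  using less_le_trans[of "0 :: ereal" 1 "fps_conv_radius F"]
  by (simp add: eval_fps_has_fps_expansion)

lemma eval_sigma_fps_expansion: "eval_fps (sigma_fps k) has_fps_expansion sigma_fps k"
  by (rule eval_fps_has_fps_expansion_ge_1[OF fps_conv_radius_sigma_fps])

lemma eval_sigma_fps_holomorphic: "eval_fps (sigma_fps k) holomorphic_on ball 0 (1 / 2500)"
  by (intro holomorphic_on_eval_fps) (auto intro!: norm_less_fps_conv_radius_sigma_fps)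

lemma eisenstein_fps_expansion:
  "E2q has_fps_expansion E2_fps" "E4q has_fps_expansion E4_fps" "E6q has_fps_expansion E6_fps"
  unfolding E2q_def [abs_def] E4q_def [abs_def] E6q_def [abs_def] E2_fps_def E4_fps_def E6_fps_def
  by (intro fps_expansion_intros eval_sigma_fps_expansion)+

lemma eisenstein_holomorphic:
  "E2q holomorphic_on ball 0 (1 / 2500)" "E4q holomorphic_on ball 0 (1 / 2500)"
  "E6q holomorphic_on ball 0 (1 / 2500)"
  unfolding E2q_def [abs_def] E4q_def [abs_def] E6q_def [abs_def]
  by (intro holomorphic_intros eval_sigma_fps_holomorphic)+

text \<open>Splitting \<open>q\<close> off the divisor sum series leaves remainders \<open>s\<close>
  and \<open>r\<close> of second order. The discriminant is \<open>1728 * q\<close> to first order,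
  as \<open>3 * 240 + 2 * 504 = 1728\<close>.\<close>

lemma eisenstein_bounds:
  assumes q: "norm q < 1 / 2500"
  shows norm_E4q_minus_1: "norm (E4q q - 1) \<le> 39 / 400"
    and norm_E6q_minus_1: "norm (E6q q - 1) \<le> 21 / 100"
    and norm_discriminant: "norm (E4q q ^ 3 - E6q q ^ 2 - 1728 * q) \<le> 80 * norm q"
proof -
  define x where "x = norm q"
  define s r where "s = eval_fps (sigma_fps 3) q - q" and "r = eval_fps (sigma_fps 5) q - q"
  have x: "0 \<le> x" "x \<le> 1 / 2500" using q by (auto simp: x_def)
  have x2: "x ^ 2 \<le> x / 2500"
    using mult_left_mono[OF x(2,1)] by (simp add: power2_eq_square)
  have "norm s \<le> 65 / 4 * x ^ 2" "norm r \<le> 65 * x ^ 2"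
    using eval_sigma_fps_bound[of q 3] eval_sigma_fps_bound[of q 5] q
    by (simp_all add: s_def r_def x_def)
  then have s: "norm s \<le> 17 / 2500 * x" and r: "norm r \<le> 65 / 2500 * x"
    using x2 x(1) by linarith+
  have sq: "norm (s + q) \<le> 2517 / 2500 * x" and rq: "norm (r + q) \<le> 2565 / 2500 * x"
    using norm_triangle_ineq[of s q] norm_triangle_ineq[of r q] s r by (simp_all add: x_def)
  have e4: "E4q q = 1 + 240 * (s + q)" and e6: "E6q q = 1 - 504 * (r + q)"
    by (simp_all add: E4q_def E6q_def s_def r_def)
  show "norm (E4q q - 1) \<le> 39 / 400"
  proof -
    have "norm (E4q q - 1) = 240 * norm (s + q)"
      by (simp only: e4 add_diff_cancel_left' norm_mult norm_numeral)
    then show ?thesis using sq x by linarith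
  qed
  show "norm (E6q q - 1) \<le> 21 / 100"
  proof -
    have "E6q q - 1 = - (504 * (r + q))"
      by (simp only: e6) simp
    then have "norm (E6q q - 1) = 504 * norm (r + q)"
      by (simp only: norm_minus_cancel norm_mult norm_numeral)
    then show ?thesis using rq x by linarith
  qed
  have norms: "norm q = x" by (simp add: x_def)
  \<comment> \<open>The linear terms in \<open>q\<close> cancel. The square of \<open>s + q\<close>
    is split into \<open>q ^ 2\<close> and \<open>s * (s + 2 * q)\<close>, similarly for
    \<open>r\<close>, and \<open>172800 - 254016 = -81216\<close>.\<close>
  have eq: "E4q q ^ 3 - E6q q ^ 2 - 1728 * q = 720 * s + 1008 * r - 81216 * q ^ 2
     + 172800 * (s * (s + 2 * q)) - 254016 * (r * (r + 2 * q)) + 13824000 * (s + q) ^ 3"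
    unfolding e4 e6 by algebra
  have "norm (s * (s + 2 * q)) \<le> (17 / 2500 * x) * (5017 / 2500 * x)"
    unfolding norm_mult using s norm_triangle_ineq[of s "2 * q"] x
    by (intro mult_mono) (auto simp: norm_mult norms)
  also have "\<dots> \<le> (17 / 2500 * (5017 / 2500)) * (x / 2500)"
    using x2 by (simp add: power2_eq_square)
  finally have b1: "norm (s * (s + 2 * q)) \<le> (17 / 2500 * (5017 / 2500)) * (x / 2500)" .
  have "norm (r * (r + 2 * q)) \<le> (65 / 2500 * x) * (5065 / 2500 * x)"
    unfolding norm_mult using r norm_triangle_ineq[of r "2 * q"] x
    by (intro mult_mono) (auto simp: norm_mult norms)
  also have "\<dots> \<le> (65 / 2500 * (5065 / 2500)) * (x / 2500)"
    using x2 by (simp add: power2_eq_square)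
  finally have b2: "norm (r * (r + 2 * q)) \<le> (65 / 2500 * (5065 / 2500)) * (x / 2500)" .
  have "norm ((s + q) ^ 3) \<le> (2517 / 2500 * x) ^ 3"
    unfolding norm_power by (intro power_mono sq) auto
  also have "\<dots> = (2517 / 2500) ^ 3 * (x ^ 2 * x)"
    by (simp add: power_mult_distrib power3_eq_cube power2_eq_square)
  also have "x ^ 2 * x \<le> x / 2500 * (1 / 2500)"
    using x x2 by (intro mult_mono) auto
  finally have b3: "norm ((s + q) ^ 3) \<le> (2517 / 2500) ^ 3 * (x / 2500 * (1 / 2500))"
    by simp
  have tri: "norm (a + b - c + d - e + f) \<le> norm a + norm b + norm c + norm d + norm e + norm f"
    for a b c d e f :: complex
    by norm
  have "norm (E4q q ^ 3 - E6q q ^ 2 - 1728 * q) \<le> 720 * norm s + 1008 * norm r + 81216 * norm (q ^ 2)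
     + 172800 * norm (s * (s + 2 * q)) + 254016 * norm (r * (r + 2 * q)) + 13824000 * norm ((s + q) ^ 3)"
    unfolding eq by (rule order_trans[OF tri]) (simp add: norm_mult)
  also have "\<dots> \<le> 80 * x"
    using s r b1 b2 b3 x2 x by (simp add: norm_power norms power_divide)
  finally show "norm (E4q q ^ 3 - E6q q ^ 2 - 1728 * q) \<le> 80 * norm q"
    by (simp add: norms)
qed

section \<open>Nonvanishing of \<open>E4\<close>, \<open>E6\<close> and the discriminant, and the
  bound |1/J| < 1\<close>

lemma norm_E4q_ge:
  assumes "norm q < 1 / 2500"
  shows "norm (E4q q) \<ge> 361 / 400"
  using norm_E4q_minus_1[OF assms] norm_triangle_ineq2[of 1 "1 - E4q q"]
  by (simp add: norm_minus_commute)

lemma E4q_nonzero: "norm q < 1 / 2500 \<Longrightarrow> E4q q \<noteq> 0"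
  using norm_E4q_ge by fastforce

lemma Re_E4q_pos:
  assumes "norm q < 1 / 2500"
  shows "Re (E4q q) > 0"
  using norm_E4q_minus_1[OF assms] abs_Re_le_cmod[of "E4q q - 1"] by simp

lemma norm_E6q_ge:
  assumes "norm q < 1 / 2500"
  shows "norm (E6q q) \<ge> 79 / 100"
  using norm_E6q_minus_1[OF assms] norm_triangle_ineq2[of 1 "1 - E6q q"]
  by (simp add: norm_minus_commute)

lemma E6q_nonzero: "norm q < 1 / 2500 \<Longrightarrow> E6q q \<noteq> 0"
  using norm_E6q_ge by fastforce

lemma discriminant_nonzero:
  assumes "norm q < 1 / 2500" "q \<noteq> 0"
  shows "E4q q ^ 3 \<noteq> E6q q ^ 2"
  using norm_discriminant[OF assms(1)] assms(2) by (auto simp: norm_mult)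

lemma Jinv_eq:
  assumes "norm q < 1 / 2500"
  shows "Jinv q = (E4q q ^ 3 - E6q q ^ 2) / E4q q ^ 3"
  using E4q_nonzero[OF assms] by (simp add: Jinv_def field_simps)

lemma norm_Jinv_less:
  assumes "norm q < 1 / 2500"
  shows "norm (Jinv q) < 1"
proof -
  have "norm (E4q q ^ 3 - E6q q ^ 2) \<le> norm (1728 * q) + 80 * norm q"
    using norm_discriminant[OF assms] norm_triangle_ineq[of "1728 * q" "E4q q ^ 3 - E6q q ^ 2 - 1728 * q"]
    by simp
  \<comment> \<open>The left side is below \<open>(1728 + 80) / 2500 = 0.7232\<close>, the right
    side is about 0.735.\<close>
  also have "\<dots> < (361 / 400) ^ 3"
    using assms by (simp add: norm_mult power_divide)
  also have "\<dots> \<le> norm (E4q q ^ 3)"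
    unfolding norm_power using norm_E4q_ge[OF assms] by (intro power_mono) auto
  finally show ?thesis
    using E4q_nonzero[OF assms] by (simp add: Jinv_eq[OF assms] norm_divide)
qed

lemma Jinv_fps_expansion: "Jinv has_fps_expansion Jinv_fps"
  unfolding Jinv_def [abs_def] Jinv_fps_def
  by (intro fps_expansion_intros eisenstein_fps_expansion) (simp add: E_fps_nth_0)

lemma Jinv_holomorphic: "Jinv holomorphic_on ball 0 (1 / 2500)"
  unfolding Jinv_def [abs_def]
  by (intro holomorphic_intros eisenstein_holomorphic) (auto simp: E4q_nonzero)

section \<open>The hypergeometric series as a function of 1/J\<close>

lemma norm_ramanujan_coeff_le: "norm (ramanujan_coeff n) \<le> 1"
proof (induction n)
  case 0
  then show ?case by (simp add: ramanujan_coeff_def)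
next
  case (Suc n)
  let ?m = "real (Suc n)"
  have "72 * ?m ^ 3 * norm (ramanujan_coeff (Suc n)) =
      norm (72 * of_nat (Suc n) ^ 3 * ramanujan_coeff (Suc n))"
    by (simp only: norm_mult norm_power norm_of_nat norm_numeral)
  also have "\<dots> = real ((6 * n + 1) * (2 * n + 1) * (6 * n + 5)) * norm (ramanujan_coeff n)"
    by (simp only: ramanujan_coeff_Suc norm_mult norm_of_nat)
  also have "\<dots> \<le> real ((6 * n + 1) * (2 * n + 1) * (6 * n + 5)) * 1"
    using Suc by (intro mult_left_mono) auto
  also have "\<dots> \<le> 72 * ?m ^ 3 * 1"
    by (simp add: power3_eq_cube algebra_simps)
  finally show ?case by (subst (asm) mult_le_cancel_left_pos) auto
qed

lemma fps_conv_radius_ramanujan: "fps_conv_radius ramanujan_fps \<ge> 1"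
  unfolding fps_conv_radius_def
proof (rule conv_radius_geI_ex')
  fix r :: real assume r: "0 < r" "ereal r < 1"
  show "summable (\<lambda>n. ramanujan_fps $ n * of_real r ^ n)"
  proof (rule summable_comparison_test)
    show "summable (\<lambda>n. r ^ n)" using r by (simp add: summable_geometric)
    show "\<exists>N. \<forall>n\<ge>N. norm (ramanujan_fps $ n * of_real r ^ n) \<le> r ^ n"
      using r norm_ramanujan_coeff_le
      by (auto simp: ramanujan_fps_def norm_mult norm_power intro!: mult_left_le_one_le)
  qed
qed

lemma fps_conv_radius_qdiff: "fps_conv_radius (qdiff F) \<ge> fps_conv_radius F"
  using fps_conv_radius_mult[of fps_X "fps_deriv F"] fps_conv_radius_deriv[of F]
  unfolding qdiff_def by simp

text \<open>Since \<open>norm (Jinv q) < 1\<close>, the composition is holomorphic on the whole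
  disc, where equal Taylor series at 0 force equality. This carries formal identities over to
  values.\<close>

lemma eval_compose_Jinv:
  assumes "fps_conv_radius F \<ge> 1" "g has_fps_expansion (F oo Jinv_fps)"
    "g holomorphic_on ball 0 (1 / 2500)" "norm q < 1 / 2500"
  shows "eval_fps F (Jinv q) = g q"
proof -
  have lt: "ereal (norm z) < fps_conv_radius F" if "norm z < 1" for z :: complex
    using that assms(1) by (metis ereal_less(3) less_le_trans)
  have "eval_fps F has_fps_expansion F"
    by (rule eval_fps_has_fps_expansion_ge_1[OF assms(1)])
  then have 1: "(eval_fps F \<circ> Jinv) has_fps_expansion (F oo Jinv_fps)"
    by (intro has_fps_expansion_compose Jinv_fps_expansion Jinv_fps_nth_0)
  have 2: "(eval_fps F \<circ> Jinv) holomorphic_on ball 0 (1 / 2500)"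
    by (intro holomorphic_on_compose Jinv_holomorphic holomorphic_on_eval_fps)
       (auto intro!: lt norm_Jinv_less)
  show ?thesis
    using has_fps_expansion_imp_eval_fps_eq[OF 1 assms(4) 2]
      has_fps_expansion_imp_eval_fps_eq[OF assms(2,4,3)] by simp
qed

lemma eval_ramanujan_fps:
  assumes q: "norm q < 1 / 2500"
  shows "eval_fps ramanujan_fps (Jinv q) = csqrt (E4q q)"
    and "6 * eval_fps (qdiff ramanujan_fps) (Jinv q) = csqrt (E4q q) * (E2q q * E4q q * inverse (E6q q) - 1)"
proof -
  let ?f = "\<lambda>q. csqrt (E4q q)"
  define F where "F = fps_expansion ?f 0"
  \<comment> \<open>A positive real part keeps \<open>E4q q\<close> off the branch cut of
    \<open>csqrt\<close>.\<close>
  have holo: "?f holomorphic_on ball 0 (1 / 2500)"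
    using Re_E4q_pos by (intro holomorphic_intros eisenstein_holomorphic)
      (force simp: complex_nonpos_Reals_iff)
  then have F: "?f has_fps_expansion F"
    unfolding F_def
    by (intro analytic_at_imp_has_fps_expansion_0 analytic_on_subset[of _ "ball 0 (1 / 2500)" "{0}"])
       (auto simp: analytic_on_open)
  have "(\<lambda>q. ?f q ^ 2) has_fps_expansion F ^ 2"
    by (intro fps_expansion_intros F)
  \<comment> \<open>The Taylor series \<open>F\<close> is the formal square root required by
    \<open>sqrt_E4_eq_ramanujan\<close>; its constant term is \<open>csqrt 1 = 1\<close>.\<close>
  then have "F ^ 2 = E4_fps"
    using fps_expansion_unique_complex[OF _ eisenstein_fps_expansion(2)] by simp
  moreover have "F $ 0 = 1"
    using has_fps_expansion_imp_0_eq_fps_nth_0[OF F]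
      has_fps_expansion_imp_0_eq_fps_nth_0[OF eisenstein_fps_expansion(2)] by (simp add: E_fps_nth_0)
  ultimately have R: "ramanujan_fps oo Jinv_fps = F" and T: "6 * theta F = F * (u_fps - 1)"
    by (rule sqrt_E4_eq_ramanujan, intro theta_sqrt_E4)
  show "eval_fps ramanujan_fps (Jinv q) = csqrt (E4q q)"
    by (rule eval_compose_Jinv[OF fps_conv_radius_ramanujan _ holo q]) (simp add: R F)
  have "qdiff ramanujan_fps oo Jinv_fps = theta F"
    by (simp add: theta_compose [symmetric] R)
  also have "\<dots> = fps_const (1 / 6) * (6 * theta F)"
    by (simp add: numeral_fps_const mult.assoc [symmetric])
  also note T
  finally have Q: "qdiff ramanujan_fps oo Jinv_fps
      = fps_const (1 / 6) * (F * (E2_fps * E4_fps * inverse E6_fps - 1))"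
    by (simp add: u_fps_def W_fps_def)
  have "eval_fps (qdiff ramanujan_fps) (Jinv q) =
     1 / 6 * (csqrt (E4q q) * (E2q q * E4q q * inverse (E6q q) - 1))"
  proof (rule eval_compose_Jinv[OF _ _ _ q])
    show "1 \<le> fps_conv_radius (qdiff ramanujan_fps)"
      using fps_conv_radius_ramanujan fps_conv_radius_qdiff by (rule order_trans)
    show "(\<lambda>q. 1 / 6 * (csqrt (E4q q) * (E2q q * E4q q * inverse (E6q q) - 1))) has_fps_expansion
        (qdiff ramanujan_fps oo Jinv_fps)"
      unfolding Q by (intro fps_expansion_intros F eisenstein_fps_expansion) (simp add: E_fps_nth_0)
    show "(\<lambda>q. 1 / 6 * (csqrt (E4q q) * (E2q q * E4q q * inverse (E6q q) - 1))) holomorphic_on ball 0 (1 / 2500)"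
      by (intro holomorphic_intros holo eisenstein_holomorphic) (auto simp: E6q_nonzero)
  qed
  then show "6 * eval_fps (qdiff ramanujan_fps) (Jinv q) =
      csqrt (E4q q) * (E2q q * E4q q * inverse (E6q q) - 1)"
    by (simp add: mult.commute)
qed

text \<open>Both sides have the same square. The right side is the principal root because
  \<open>csqrt (E4q q) ^ 3\<close> and \<open>E6q q\<close> are so close to 1 that their quotient
  has positive real part.\<close>

lemma csqrt_E4q_cube_over_E6q:
  assumes q: "norm q < 1 / 2500"
  shows "csqrt (E4q q ^ 3 / E6q q ^ 2) = csqrt (E4q q) ^ 3 / E6q q"
proof -
  define w where "w = csqrt (E4q q)"
  have w2: "w ^ 2 = E4q q" by (simp add: w_def)
  \<comment> \<open>A principal root has nonnegative real part; with
    \<open>norm (w + 1) \<ge> 1\<close>, the distance of \<open>w\<close> from 1 is at most that of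
    \<open>w ^ 2\<close>.\<close>
  have "Re (w + 1) \<ge> 1"
    using Re_csqrt[of "E4q q"] by (simp add: w_def)
  then have "norm (w + 1) \<ge> 1"
    using complex_Re_le_cmod[of "w + 1"] by linarith
  then have "norm (w - 1) * 1 \<le> norm (w - 1) * norm (w + 1)"
    by (intro mult_left_mono) auto
  also have "\<dots> = norm (E4q q - 1)"
    by (simp add: w2 [symmetric] norm_mult [symmetric] power2_eq_square algebra_simps)
  finally have w1: "norm (w - 1) \<le> 39 / 400"
    using norm_E4q_minus_1[OF q] by simp
  have "norm (E4q q + w + 1) \<le> 3 + 78 / 400"
    using w1 norm_E4q_minus_1[OF q] norm_triangle_ineq[of "(E4q q - 1) + (w - 1)" 3]
      norm_triangle_ineq[of "E4q q - 1" "w - 1"] by (simp add: algebra_simps)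
  with w1 have "norm (w - 1) * norm (E4q q + w + 1) \<le> 39 / 400 * (3 + 78 / 400)"
    by (intro mult_mono) auto
  moreover have "w ^ 3 - 1 = (w - 1) * (E4q q + w + 1)"
    unfolding w2 [symmetric] by algebra
  ultimately have w3: "norm (w ^ 3 - 1) \<le> 39 / 400 * (3 + 78 / 400)"
    by (simp add: norm_mult)
  have "norm (w ^ 3 - E6q q) \<le> norm (w ^ 3 - 1) + norm (E6q q - 1)"
    using norm_triangle_ineq4[of "w ^ 3 - 1" "E6q q - 1"] by simp
  \<comment> \<open>The sum is at most 0.312 + 0.21.\<close>
  also have "\<dots> < 79 / 100"
    using w3 norm_E6q_minus_1[OF q] by simp
  also have "\<dots> \<le> norm (E6q q)" by (rule norm_E6q_ge[OF q])
  finally have "norm ((w ^ 3 - E6q q) / E6q q) < 1"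
    using E6q_nonzero[OF q] by (simp add: norm_divide)
  moreover have "(w ^ 3 - E6q q) / E6q q = w ^ 3 / E6q q - 1"
    using E6q_nonzero[OF q] by (simp add: field_simps)
  ultimately have "Re (w ^ 3 / E6q q) > 0"
    using abs_Re_le_cmod[of "w ^ 3 / E6q q - 1"] by simp
  then have "csqrt ((w ^ 3 / E6q q) ^ 2) = w ^ 3 / E6q q"
    by (intro csqrt_square) auto
  moreover have "(w ^ 3 / E6q q) ^ 2 = E4q q ^ 3 / E6q q ^ 2"
    by (simp add: w2 [symmetric] power_divide flip: power_mult)
  ultimately show ?thesis by (simp add: w_def)
qed

theorem mainTheorem1:
  fixes \<tau> :: complex
  assumes "Im \<tau> > 5/4"
  defines "a \<equiv> (\<lambda>n::nat. ((1 - s2 \<tau>) / 6 + of_nat n)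
                  * (of_nat (fact (6*n)) / (of_nat (fact (3*n)) * of_nat (fact n) ^ 3))
                  * (1 / (1728 * Jfun \<tau>) ^ n))"
  shows "summable (\<lambda>n. norm (a n)) \<and>
         a sums (1 / (2 * complex_of_real pi * complex_of_real (Im \<tau>))
                  * csqrt (Jfun \<tau> / (Jfun \<tau> - 1)))"
proof -
  define q where "q = qnome \<tau>"
  have "q \<noteq> 0" by (simp add: q_def qnome_def)
  have "norm q = exp (- (2 * pi * Im \<tau>))"
    by (simp add: q_def qnome_def norm_exp_eq_Re)
  also have "\<dots> < exp (- (5 / 2 * pi))"
    using assms(1) by simp
  also have "\<dots> = 1 / exp (5 / 2 * pi)"
    by (simp add: exp_minus inverse_eq_divide)
  also have "\<dots> < 1 / 2500"
    using exp_gt_2500 by (intro divide_strict_left_mono) auto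
  finally have q: "norm q < 1 / 2500" .
  then have E: "E2 \<tau> = E2q q" "E4 \<tau> = E4q q" "E6 \<tau> = E6q q"
    unfolding q_def by (intro eisenstein_eq_eval; linarith)+
  define t w y where "t = Jinv q" and "w = csqrt (E4q q)" and "y = complex_of_real pi * complex_of_real (Im \<tau>)"
  have y: "y \<noteq> 0" using assms(1) by (simp add: y_def)
  have e4: "E4q q \<noteq> 0" and e6: "E6q q \<noteq> 0" and disc: "E4q q ^ 3 - E6q q ^ 2 \<noteq> 0"
    using E4q_nonzero E6q_nonzero discriminant_nonzero q \<open>q \<noteq> 0\<close> by auto
  have J: "Jfun \<tau> = E4q q ^ 3 / (E4q q ^ 3 - E6q q ^ 2)"
    by (simp add: Jfun_def E)
  have Jt: "1 / Jfun \<tau> = t"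
    by (simp add: J t_def Jinv_eq[OF q])
  have "Jfun \<tau> - 1 = E6q q ^ 2 / (E4q q ^ 3 - E6q q ^ 2)"
    using disc by (simp add: J field_simps)
  then have JJ: "Jfun \<tau> / (Jfun \<tau> - 1) = E4q q ^ 3 / E6q q ^ 2"
    using disc by (simp add: J)
  define c where "c = (1 - s2 \<tau>) / 6"
  \<comment> \<open>The summand \<open>n\<close> of the linear factor becomes \<open>qdiff\<close>,
    so the series is \<open>c F(t) + t F'(t)\<close>.\<close>
  have a: "a n = c * (ramanujan_fps $ n * t ^ n) + qdiff ramanujan_fps $ n * t ^ n" for n
  proof -
    have "1 / (1728 * Jfun \<tau>) ^ n = t ^ n / 1728 ^ n"
      by (simp add: Jt [symmetric] power_mult_distrib power_divide)
    then show ?thesis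
      unfolding a_def c_def [symmetric] ramanujan_fps_def fps_nth_Abs_fps qdiff_nth ramanujan_coeff_def
      by (simp only: ring_distribs) (simp add: mult_ac)
  qed
  have t1: "norm t < 1" unfolding t_def by (rule norm_Jinv_less[OF q])
  have conv: "ereal (norm t) < fps_conv_radius ramanujan_fps"
      "ereal (norm t) < fps_conv_radius (qdiff ramanujan_fps)"
    using t1 fps_conv_radius_ramanujan fps_conv_radius_qdiff[of ramanujan_fps]
    by (metis ereal_less(3) less_le_trans)+
  have "summable (\<lambda>n. norm (a n))"
  proof (rule summable_comparison_test)
    show "summable (\<lambda>n. norm c * norm (ramanujan_fps $ n * t ^ n) + norm (qdiff ramanujan_fps $ n * t ^ n))"
      using conv unfolding fps_conv_radius_def
      by (intro summable_add summable_mult abs_summable_in_conv_radius)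
    show "\<exists>N. \<forall>n\<ge>N. norm (norm (a n)) \<le>
        norm c * norm (ramanujan_fps $ n * t ^ n) + norm (qdiff ramanujan_fps $ n * t ^ n)"
      unfolding a using norm_triangle_ineq by (metis norm_mult real_norm_def abs_norm_cancel)
  qed
  moreover have "a sums (c * eval_fps ramanujan_fps t + eval_fps (qdiff ramanujan_fps) t)"
    unfolding a [abs_def] by (intro sums_add sums_mult sums_eval_fps conv)
  moreover have "c * eval_fps ramanujan_fps t + eval_fps (qdiff ramanujan_fps) t =
      1 / (2 * complex_of_real pi * complex_of_real (Im \<tau>)) * csqrt (Jfun \<tau> / (Jfun \<tau> - 1))"
  proof -
    have "6 * (c * eval_fps ramanujan_fps t + eval_fps (qdiff ramanujan_fps) t) =
        (6 * c) * eval_fps ramanujan_fps t + 6 * eval_fps (qdiff ramanujan_fps) t"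
      by (simp add: algebra_simps)
    also have "\<dots> = (1 - s2 \<tau>) * w + w * (E2q q * E4q q * inverse (E6q q) - 1)"
      unfolding t_def eval_ramanujan_fps[OF q] by (simp add: c_def w_def)
    also have "\<dots> = 3 * (E4q q * w / E6q q) / y"
      using e6 y by (simp add: s2_def E y_def [symmetric] field_simps)
    also have "E4q q * w = w ^ 3"
      by (simp add: w_def power3_eq_cube flip: power2_eq_square)
    finally have six: "6 * (c * eval_fps ramanujan_fps t + eval_fps (qdiff ramanujan_fps) t) =
        3 * (w ^ 3 / E6q q) / y" .
    have "X = 1 / (2 * y) * W" if "6 * X = 3 * W / y" for X W
    proof -
      have "X = 6 * X / 6" by simp
      also have "\<dots> = 1 / (2 * y) * W" unfolding that by simp
      finally show ?thesis .
    qed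
    note this [OF six]
    then show ?thesis
      unfolding JJ csqrt_E4q_cube_over_E6q[OF q] w_def [symmetric] by (simp add: y_def mult.assoc)
  qed
  ultimately show ?thesis by simp
qed

end
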